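(* Fix an integer $\Lambda \ge 2$. Let $G=(V,E)$ be a loopless series-parallel graph of maxmaxflow at most $\Lambda$, and let the edge weights $\mathbf v=(v_e)_{e\in E}$ be real numbers with $v_e\in[-1,0]$ for all $e$. Then every root $q\in\mathbb{C}$ of $q\mapsto Z_G(q,\mathbf v)$ satisfies $|q-1| < (\Lambda-1)/\log 2$.
   Context: Graphs are finite and undirected and may have loops and multiple edges. For a graph $G=(V,E)$, $q\in\mathbb{C}$ and edge weights $\mathbf v=(v_e)_{e\in E}$, the multivariate Tutte polynomial is $Z_G(q,\mathbf v)=\sum_{A\subseteq E} q^{k(A)}\prod_{e\in A} v_e$, where $k(A)$ is the number of connected components of the spanning subgraph $(V,A)$. For distinct vertices $x,y$, $\lambda_G(x,y)$ denotes the maximum number of pairwise edge-disjoint paths from $x$ to $y$; the maxmaxflow of $G$ is $\Lambda(G)=\max_{x\neq y}\lambda_G(x,y)$ (taken to be $0$ if $G$ has fewer than two vertices). A loopless graph is series-parallel if it can be obtained from a forest by a finite (possibly empty) sequence of operations, each of which replaces an edge either by two edges in series (i.e. subdivides it with a new vertex of degree 2) or by two parallel edges with the same endpoints. *)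

theory Defs
  imports Complex_Main
begin

text \<open>A finite multigraph is given by a vertex set V, an edge set E and an
endpoint map ends assigning to each edge the set of its endpoints
(one endpoint for a loop, two for an ordinary edge).  Multiple edges are
distinct edge names with equal endpoint sets.\<close>

definition multigraph :: "'v set \<Rightarrow> 'e set \<Rightarrow> ('e \<Rightarrow> 'v set) \<Rightarrow> bool" where
  "multigraph V E ends \<longleftrightarrow> finite V \<and> finite E \<and>
     (\<forall>e\<in>E. ends e \<subseteq> V \<and> (card (ends e) = 1 \<or> card (ends e) = 2))"

definition loopless :: "'v set \<Rightarrow> 'e set \<Rightarrow> ('e \<Rightarrow> 'v set) \<Rightarrow> bool" where
  "loopless V E ends \<longleftrightarrow> (\<forall>e\<in>E. card (ends e) = 2)"

definition is_cycle :: "'v set \<Rightarrow> 'e set \<Rightarrow> ('e \<Rightarrow> 'v set) \<Rightarrow> 'v list \<Rightarrow> 'e list \<Rightarrow> bool" where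
  "is_cycle V E ends vs es \<longleftrightarrow> es \<noteq> [] \<and> length vs = length es + 1 \<and>
     set es \<subseteq> E \<and> distinct es \<and> hd vs = last vs \<and> distinct (butlast vs) \<and>
     (\<forall>i<length es. ends (es ! i) = {vs ! i, vs ! Suc i})"

definition forest :: "'v set \<Rightarrow> 'e set \<Rightarrow> ('e \<Rightarrow> 'v set) \<Rightarrow> bool" where
  "forest V E ends \<longleftrightarrow> multigraph V E ends \<and> loopless V E ends \<and>
     \<not> (\<exists>vs es. is_cycle V E ends vs es)"

inductive series_parallel :: "'v set \<Rightarrow> 'e set \<Rightarrow> ('e \<Rightarrow> 'v set) \<Rightarrow> bool" where
  sp_forest: "forest V E ends \<Longrightarrow> series_parallel V E ends"
| sp_series: "\<lbrakk>series_parallel V E ends; e \<in> E; ends e = {a, b}; a \<noteq> b; w \<notin> V; f \<notin> E\<rbrakk>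
     \<Longrightarrow> series_parallel (insert w V) (insert f E) (ends(e := {a, w}, f := {w, b}))"
| sp_parallel: "\<lbrakk>series_parallel V E ends; e \<in> E; f \<notin> E\<rbrakk>
     \<Longrightarrow> series_parallel V (insert f E) (ends(f := ends e))"

definition adj_rel :: "'e set \<Rightarrow> ('e \<Rightarrow> 'v set) \<Rightarrow> ('v \<times> 'v) set" where
  "adj_rel A ends = {(x, y). \<exists>e\<in>A. x \<in> ends e \<and> y \<in> ends e}"

definition num_components :: "'v set \<Rightarrow> 'e set \<Rightarrow> ('e \<Rightarrow> 'v set) \<Rightarrow> nat" where
  "num_components V A ends = card ((\<lambda>x. {y\<in>V. (x, y) \<in> (adj_rel A ends)\<^sup>*}) ` V)"

definition tutte_Z :: "'v set \<Rightarrow> 'e set \<Rightarrow> ('e \<Rightarrow> 'v set) \<Rightarrow> complex \<Rightarrow> ('e \<Rightarrow> complex) \<Rightarrow> complex" where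
  "tutte_Z V E ends q v = (\<Sum>A\<in>Pow E. q ^ num_components V A ends * (\<Prod>e\<in>A. v e))"

definition is_path :: "'v set \<Rightarrow> 'e set \<Rightarrow> ('e \<Rightarrow> 'v set) \<Rightarrow> 'v \<Rightarrow> 'v \<Rightarrow> 'v list \<Rightarrow> 'e list \<Rightarrow> bool" where
  "is_path V E ends x y vs es \<longleftrightarrow> length vs = length es + 1 \<and> set es \<subseteq> E \<and>
     hd vs = x \<and> last vs = y \<and> distinct vs \<and>
     (\<forall>i<length es. ends (es ! i) = {vs ! i, vs ! Suc i})"

definition local_edge_conn :: "'v set \<Rightarrow> 'e set \<Rightarrow> ('e \<Rightarrow> 'v set) \<Rightarrow> 'v \<Rightarrow> 'v \<Rightarrow> nat" where
  "local_edge_conn V E ends x y = Max {k. \<exists>P :: nat \<Rightarrow> 'v list \<times> 'e list.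
      (\<forall>i<k. is_path V E ends x y (fst (P i)) (snd (P i))) \<and>
      (\<forall>i<k. \<forall>j<k. i \<noteq> j \<longrightarrow> set (snd (P i)) \<inter> set (snd (P j)) = {})}"

definition maxmaxflow :: "'v set \<Rightarrow> 'e set \<Rightarrow> ('e \<Rightarrow> 'v set) \<Rightarrow> nat" where
  "maxmaxflow V E ends = (if card V < 2 then 0 else
     Max {local_edge_conn V E ends x y | x y. x \<in> V \<and> y \<in> V \<and> x \<noteq> y})"

end

theory Submission
  imports Defs
begin

text \<open>Suppose \<open>Q = |q - 1| \<ge> (\<Lambda> - 1) / ln 2\<close>.  Undo the series and parallel operations one at a time,
  replacing the two edges by a single effective edge.  Besides its effective weight \<open>v\<close>, each edge
  carries a capacity, and any two vertices remain separated by a cut of capacity at most \<open>\<Lambda>\<close>; for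
  the original graph with unit capacities this is Menger's theorem.

  Put \<open>y = 1 + v\<close> and \<open>t = v / (q + v)\<close>, so that parallel connection multiplies \<open>y\<close> and series
  connection multiplies \<open>t\<close>.  In the coordinate \<open>y\<close>, an edge of capacity \<open>k < \<Lambda>\<close> lies in the region
  \<open>[0,1] \<cdot> D\<^sub>k\<close>, where \<open>D\<^sub>k\<close> is the disc \<open>|t| \<le> r\<^sub>k\<close>, \<open>r\<^sub>1 = 1 / Q\<^sup>2\<close> and \<open>(1 + Q r\<^sub>k) / (1 + r\<^sub>k)\<close> is
  the \<open>k\<close>-th power of \<open>(1 + Q r\<^sub>1) / (1 + r\<^sub>1)\<close>.  The lower bound on \<open>Q\<close> gives \<open>r\<^sub>k \<le> 1 / Q\<close> for
  \<open>k < \<Lambda>\<close>; as \<open>|t| \<le> 1 / Q\<close> is convex in \<open>y\<close> and contains \<open>y = 0\<close>, it contains all the regions.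
  Hence a series connection lands in \<open>D\<^sub>1\<close> again and its capacity can be reset to \<open>1\<close>, while a
  parallel connection adds capacities.  An edge whose capacity reaches \<open>\<Lambda>\<close> is a bridge, for which
  only \<open>q + v \<noteq> 0\<close> matters.\<close>

section \<open>A numerical inequality\<close>

text \<open>The bound is the [2/1] Pade approximant of the logarithm: the difference vanishes at 0
  and its derivative is \<open>4 * t ^ 3\<close> over a positive denominator.\<close>

lemma ln_one_plus_le_pade:
  fixes x :: real
  assumes "0 \<le> x"
  shows "ln (1 + x) \<le> x * (6 + x) / (6 + 4 * x)"
proof -
  let ?h = "\<lambda>x::real. x * (6 + x) / (6 + 4 * x) - ln (1 + x)"
  have "?h 0 \<le> ?h x"
  proof (rule DERIV_nonneg_imp_nondecreasing[OF assms])
    fix t :: real assume t: "0 \<le> t" "t \<le> x"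
    have "(?h has_real_derivative
        ((6 + 2 * t) * (6 + 4 * t) - t * (6 + t) * 4) / ((6 + 4 * t) * (6 + 4 * t)) - 1 / (1 + t)) (at t)"
      using t by (auto intro!: derivative_eq_intros simp: field_simps)
    moreover have "((6 + 2 * t) * (6 + 4 * t) - t * (6 + t) * 4) / ((6 + 4 * t) * (6 + 4 * t)) - 1 / (1 + t)
        = 4 * t ^ 3 / ((6 + 4 * t) * (6 + 4 * t) * (1 + t))"
      using t by (simp add: divide_simps) algebra
    ultimately have "(?h has_real_derivative 4 * t ^ 3 / ((6 + 4 * t) * (6 + 4 * t) * (1 + t))) (at t)"
      by (simp only:)
    moreover have "0 \<le> 4 * t ^ 3 / ((6 + 4 * t) * (6 + 4 * t) * (1 + t))" using t by simp
    ultimately show "\<exists>d. (?h has_real_derivative d) (at t) \<and> 0 \<le> d" by blast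
  qed
  then show ?thesis by simp
qed

lemma ln_one_plus_ge_pade:
  fixes x :: real
  assumes "0 \<le> x"
  shows "2 * x / (2 + x) \<le> ln (1 + x)"
proof -
  let ?h = "\<lambda>x::real. ln (1 + x) - 2 * x / (2 + x)"
  have "?h 0 \<le> ?h x"
  proof (rule DERIV_nonneg_imp_nondecreasing[OF assms])
    fix t :: real assume t: "0 \<le> t" "t \<le> x"
    have "(?h has_real_derivative 1 / (1 + t) - (2 * (2 + t) - 2 * t) / ((2 + t) * (2 + t))) (at t)"
      using t by (auto intro!: derivative_eq_intros simp: field_simps)
    moreover have "1 / (1 + t) - (2 * (2 + t) - 2 * t) / ((2 + t) * (2 + t))
        = t ^ 2 / ((2 + t) * (2 + t) * (1 + t))"
      using t by (simp add: divide_simps) algebra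
    ultimately have "(?h has_real_derivative t ^ 2 / ((2 + t) * (2 + t) * (1 + t))) (at t)"
      by (simp only:)
    moreover have "0 \<le> t ^ 2 / ((2 + t) * (2 + t) * (1 + t))" using t by simp
    ultimately show "\<exists>d. (?h has_real_derivative d) (at t) \<and> 0 \<le> d" by blast
  qed
  then show ?thesis by simp
qed

lemma ln_2_bounds: "2 / 3 \<le> ln (2::real)" "ln (2::real) \<le> 7 / 10"
  using ln_one_plus_ge_pade[of 1] ln_one_plus_le_pade[of 1] by auto

text \<open>Divided by \<open>x = 1 / Q\<close>, this is the logarithm of
  \<open>disc_mult Q ^ m \<le> 2 * Q / (Q + 1)\<close> with \<open>m\<close> replaced by its largest
  real value \<open>Q * ln 2\<close>. The logarithms are then exchanged for their rational
  bounds.\<close>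

lemma ln_two_growth_inequality:
  fixes x :: real
  assumes "0 < x" "x \<le> ln 2"
  shows "(x + ln 2) * ln (1 + x) \<le> x * ln 2 + ln 2 * ln (1 + x\<^sup>2)"
proof -
  define L where "L = ln (2::real)"
  have L: "2 / 3 \<le> L" "x \<le> L" "x \<le> 7 / 10"
    using assms ln_2_bounds by (auto simp: L_def)
  have xx: "x * x \<le> 7 / 10 * x" "x * x * x \<le> 49 / 100 * x"
  proof -
    show 1: "x * x \<le> 7 / 10 * x" using L assms by (intro mult_right_mono) auto
    have "x * x * x \<le> 7 / 10 * x * x" using 1 assms by (intro mult_right_mono) auto
    also have "\<dots> \<le> 49 / 100 * x" using 1 by simp
    finally show "x * x * x \<le> 49 / 100 * x" .
  qed
  \<comment> \<open>The factor left over when the difference of the rational bounds is put over one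
    denominator and \<open>x * x\<close> is taken out. It increases with \<open>L\<close>, so
    \<open>L = 2 / 3\<close> is the worst case, and \<open>x \<le> 7 / 10\<close> then controls the
    negative terms.\<close>
  have p: "0 \<le> (18 * L - 12) + (8 * L - 2) * x + (3 * L - 6) * (x * x) - x * x * x"
  proof -
    have "2 / 3 * (8 * x + 3 * (x * x)) \<le> L * (8 * x + 3 * (x * x))"
      using L assms by (intro mult_right_mono) auto
    moreover have "(18 * L - 12) + (8 * L - 2) * x + (3 * L - 6) * (x * x) - x * x * x
        = (18 * L - 12) + L * (8 * x + 3 * (x * x)) - 2 * x - 6 * (x * x) - x * x * x"
      by (simp add: algebra_simps)
    moreover have "2 / 3 * (8 * x + 3 * (x * x)) = 16 / 3 * x + 2 * (x * x)" by simp
    ultimately show ?thesis using xx assms L by linarith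
  qed
  have "(x + L) * ln (1 + x) \<le> (x + L) * (x * (6 + x) / (6 + 4 * x))"
    using ln_one_plus_le_pade[of x] L assms by (intro mult_left_mono) auto
  also have "\<dots> \<le> x * L + L * (2 * x\<^sup>2 / (2 + x\<^sup>2))"
  proof -
    have "x * L + L * (2 * x\<^sup>2 / (2 + x\<^sup>2)) - (x + L) * (x * (6 + x) / (6 + 4 * x))
      = x * x * ((18 * L - 12) + (8 * L - 2) * x + (3 * L - 6) * (x * x) - x * x * x)
        / ((2 + x\<^sup>2) * (6 + 4 * x))"
    proof -
      have "2 + x\<^sup>2 > 0" "6 + 4 * x > 0" using assms by (auto intro: add_pos_nonneg)
      then have "2 + x\<^sup>2 \<noteq> 0" "6 + 4 * x \<noteq> 0" by linarith+
      then show ?thesis by (simp add: divide_simps) algebra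
    qed
    moreover have "\<dots> \<ge> 0"
      using p assms by (intro divide_nonneg_nonneg mult_nonneg_nonneg) auto
    ultimately show ?thesis by linarith
  qed
  also have "\<dots> \<le> x * L + L * ln (1 + x\<^sup>2)"
    using ln_one_plus_ge_pade[of "x\<^sup>2"] L by (intro add_left_mono mult_left_mono) auto
  finally show ?thesis by (simp add: L_def)
qed

text \<open>The value of \<open>(1 + Q r) / (1 + r)\<close> at \<open>r = 1 / Q\<^sup>2\<close>.\<close>

definition disc_mult :: "real \<Rightarrow> real" where
  "disc_mult Q = Q * (Q + 1) / (Q\<^sup>2 + 1)"

text \<open>The right side is \<open>(1 + Q r) / (1 + r)\<close> at \<open>r = 1 / Q\<close>, so the
  claim is that the radius belonging to the \<open>m\<close>-th power is at most
  \<open>1 / Q\<close>.\<close>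

lemma disc_mult_power_le:
  assumes "1 \<le> m" "real m / ln 2 \<le> Q"
  shows "disc_mult Q ^ m \<le> 2 * Q / (Q + 1)"
proof -
  have L: "0 < ln (2::real)" "ln (2::real) < 1" using ln_2_bounds by auto
  have "1 / ln 2 \<le> real m / ln 2" using assms(1) L by (intro divide_right_mono) auto
  with assms(2) have Q: "1 / ln 2 \<le> Q" by linarith
  have "0 < 1 / ln (2::real)" using L by simp
  with Q have Q0: "Q > 0" by linarith
  define x where "x = 1 / Q"
  have x: "0 < x" "x \<le> ln 2" "Q = 1 / x"
    using Q Q0 L by (auto simp: x_def field_simps)
  have sp: "1 + x\<^sup>2 > 0" by (simp add: add_pos_nonneg)
  have D: "disc_mult Q = (1 + x) / (1 + x\<^sup>2)"
  proof -
    have "Q\<^sup>2 + 1 \<noteq> 0" using zero_le_power2[of Q] by linarith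
    then show ?thesis
      using Q0 unfolding disc_mult_def x_def by (simp add: divide_simps power2_eq_square)
  qed
  have "0 \<le> ln ((1 + x) / (1 + x\<^sup>2))"
  proof -
    have "x * x \<le> x" using x L by (intro mult_left_le) auto
    then show ?thesis using x sp by (intro ln_ge_zero) (auto simp: power2_eq_square)
  qed
  have "real m \<le> ln 2 * Q" using assms(2) L by (simp add: field_simps)
  then have "real m * ln ((1 + x) / (1 + x\<^sup>2)) \<le> ln 2 * Q * ln ((1 + x) / (1 + x\<^sup>2))"
    using \<open>0 \<le> ln ((1 + x) / (1 + x\<^sup>2))\<close> by (intro mult_right_mono)
  also have "\<dots> = ln 2 / x * (ln (1 + x) - ln (1 + x\<^sup>2))"
    using x sp by (simp add: ln_div)
  also have "\<dots> \<le> ln 2 - ln (1 + x)"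
    using ln_two_growth_inequality[OF x(1,2)] x by (simp add: field_simps)
  also have "\<dots> = ln (2 / (1 + x))" using x by (simp add: ln_div)
  finally have "ln (((1 + x) / (1 + x\<^sup>2)) ^ m) \<le> ln (2 / (1 + x))"
    using x sp by (simp add: ln_realpow)
  then have "((1 + x) / (1 + x\<^sup>2)) ^ m \<le> 2 / (1 + x)"
    using x sp by (subst (asm) ln_le_cancel_iff) auto
  moreover have "2 / (1 + x) = 2 * Q / (Q + 1)" using Q0 by (simp add: x_def divide_simps)
  ultimately show ?thesis by (simp only: D)
qed

section \<open>Regions for effective edge weights\<close>

text \<open>The disc \<open>|t| \<le> r\<close> with \<open>(1 + Q r) / (1 + r) = Y\<close>, that is, \<open>r = (Y - 1) / (Q - Y)\<close>.\<close>

definition in_disc :: "complex \<Rightarrow> real \<Rightarrow> complex \<Rightarrow> bool" where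
  "in_disc q Y y \<longleftrightarrow> (cmod (q - 1) - Y) * cmod (y - 1) \<le> (Y - 1) * cmod (y + q - 1)"

lemma in_disc_mono:
  assumes "in_disc q Y y" "Y \<le> Y'"
  shows "in_disc q Y' y"
proof -
  have "(cmod (q - 1) - Y') * cmod (y - 1) \<le> (cmod (q - 1) - Y) * cmod (y - 1)"
    using assms by (intro mult_right_mono) auto
  also have "\<dots> \<le> (Y - 1) * cmod (y + q - 1)" using assms by (simp add: in_disc_def)
  also have "\<dots> \<le> (Y' - 1) * cmod (y + q - 1)" using assms by (intro mult_right_mono) auto
  finally show ?thesis by (simp add: in_disc_def)
qed

lemma in_disc_one: "1 \<le> Y \<Longrightarrow> in_disc q Y 1"
  by (simp add: in_disc_def)

text \<open>With \<open>t = (y - 1) / (y + q - 1)\<close>, dividing the first identity by the second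
  gives the parallel rule
  \<open>t = (t1 + t2 + (q - 2) t1 t2) / (1 + (q - 1) t1 t2)\<close>.\<close>

lemma parallel_transmissivity:
  fixes q y1 y2 :: "'a::comm_ring_1"
  shows "q * (y1 * y2 - 1) = (y1 - 1) * (y2 + q - 1) + (y2 - 1) * (y1 + q - 1)
      + (q - 2) * ((y1 - 1) * (y2 - 1))"
    and "q * (y1 * y2 + q - 1) = (y1 + q - 1) * (y2 + q - 1) + (q - 1) * ((y1 - 1) * (y2 - 1))"
  by (simp_all add: algebra_simps)

text \<open>The triangle inequality in the parallel rule bounds \<open>|t|\<close> by
  \<open>(r1 + r2 + (Q + 1) r1 r2) / (1 - Q r1 r2)\<close>. Up to sign this is the value of the rule
  itself at \<open>q = 1 - Q\<close> and \<open>t1 = -r1\<close>, \<open>t2 = -r2\<close>, where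
  \<open>y1 = Y1\<close> and \<open>y2 = Y2\<close>; hence the new radius belongs exactly to
  \<open>Y1 * Y2\<close>.\<close>

lemma in_disc_mult:
  assumes "q \<noteq> 0" "1 \<le> Y1" "1 \<le> Y2" "Y1 * Y2 < cmod (q - 1)"
    and "in_disc q Y1 y1" "in_disc q Y2 y2"
  shows "in_disc q (Y1 * Y2) (y1 * y2)"
proof -
  define Q where "Q = cmod (q - 1)"
  define n1 n2 w1 w2 where nw: "n1 = cmod (y1 - 1)" "n2 = cmod (y2 - 1)"
    "w1 = cmod (y1 + q - 1)" "w2 = cmod (y2 + q - 1)"
  have nn: "0 \<le> n1" "0 \<le> n2" "0 \<le> w1" "0 \<le> w2" by (auto simp: nw)
  have Y: "Y1 \<le> Y1 * Y2" "Y2 \<le> Y1 * Y2"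
    using assms mult_left_mono[of 1 Y2 Y1] mult_right_mono[of 1 Y1 Y2] by auto
  have b: "0 < Q - Y1" "0 < Q - Y2" using Y assms unfolding Q_def by linarith+
  have "cmod (q - 2) \<le> Q + 1"
    using norm_triangle_ineq4[of "q - 1" 1] by (simp add: Q_def)
  have up: "cmod q * cmod (y1 * y2 - 1) \<le> n1 * w2 + n2 * w1 + (Q + 1) * (n1 * n2)"
  proof -
    have "cmod (q * (y1 * y2 - 1)) \<le> cmod ((y1 - 1) * (y2 + q - 1)) + cmod ((y2 - 1) * (y1 + q - 1))
      + cmod ((q - 2) * ((y1 - 1) * (y2 - 1)))"
      unfolding parallel_transmissivity(1) by (intro norm_triangle_mono order_refl)
    moreover have "cmod ((q - 2) * ((y1 - 1) * (y2 - 1))) \<le> (Q + 1) * (n1 * n2)"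
      unfolding norm_mult nw by (intro mult_right_mono) (use \<open>cmod (q - 2) \<le> Q + 1\<close> in auto)
    ultimately show ?thesis by (simp add: norm_mult nw)
  qed
  have lo: "w1 * w2 - Q * (n1 * n2) \<le> cmod q * cmod (y1 * y2 + q - 1)"
    using norm_diff_ineq[of "(y1 + q - 1) * (y2 + q - 1)" "(q - 1) * ((y1 - 1) * (y2 - 1))"]
    by (simp add: norm_mult nw Q_def flip: parallel_transmissivity(2))
  define r1 r2 where r: "r1 = (Y1 - 1) / (Q - Y1)" "r2 = (Y2 - 1) / (Q - Y2)"
  have h: "n1 \<le> r1 * w1" "n2 \<le> r2 * w2" and r0: "0 \<le> r1" "0 \<le> r2"
    using assms b by (auto simp: r in_disc_def nw Q_def pos_le_divide_eq mult.commute)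
  \<comment> \<open>If \<open>r\<close> is the radius belonging to \<open>Y1 * Y2\<close>, this says
    \<open>r * (1 - Q * (r1 * r2)) = r1 + r2 + (Q + 1) * (r1 * r2)\<close>.\<close>
  have id: "(Q - Y1 * Y2) * (r1 + r2 + (Q + 1) * (r1 * r2)) + (Y1 * Y2 - 1) * (Q * (r1 * r2)) = Y1 * Y2 - 1"
  proof -
    have "Q - Y1 \<noteq> 0" "Q - Y2 \<noteq> 0" using b by auto
    then show ?thesis unfolding r by (simp add: divide_simps) (simp add: algebra_simps)
  qed
  have "(Q - Y1 * Y2) * (n1 * w2 + n2 * w1 + (Q + 1) * (n1 * n2)) + (Y1 * Y2 - 1) * (Q * (n1 * n2))
     \<le> (Q - Y1 * Y2) * ((r1 * w1) * w2 + (r2 * w2) * w1 + (Q + 1) * ((r1 * w1) * (r2 * w2)))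
        + (Y1 * Y2 - 1) * (Q * ((r1 * w1) * (r2 * w2)))"
  proof -
    have "0 \<le> Q" "0 \<le> Q - Y1 * Y2" "0 \<le> Y1 * Y2 - 1" using assms Y unfolding Q_def by (simp, linarith+)
    moreover have "n1 * n2 \<le> (r1 * w1) * (r2 * w2)" using h nn by (intro mult_mono) auto
    ultimately show ?thesis using h nn by (intro add_mono mult_left_mono mult_right_mono) auto
  qed
  also have "\<dots> = (Y1 * Y2 - 1) * (w1 * w2)"
    using arg_cong[OF id, of "\<lambda>s. s * (w1 * w2)"] by (simp add: algebra_simps)
  finally have main: "(Q - Y1 * Y2) * (n1 * w2 + n2 * w1 + (Q + 1) * (n1 * n2))
     \<le> (Y1 * Y2 - 1) * (w1 * w2 - Q * (n1 * n2))"
    by (simp add: algebra_simps)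
  have "cmod q * ((Q - Y1 * Y2) * cmod (y1 * y2 - 1)) = (Q - Y1 * Y2) * (cmod q * cmod (y1 * y2 - 1))"
    by simp
  also have "\<dots> \<le> (Q - Y1 * Y2) * (n1 * w2 + n2 * w1 + (Q + 1) * (n1 * n2))"
    using up assms by (intro mult_left_mono) (auto simp: Q_def)
  also note main
  also have "(Y1 * Y2 - 1) * (w1 * w2 - Q * (n1 * n2)) \<le> (Y1 * Y2 - 1) * (cmod q * cmod (y1 * y2 + q - 1))"
    using lo assms Y by (intro mult_left_mono) linarith+
  also have "\<dots> = cmod q * ((Y1 * Y2 - 1) * cmod (y1 * y2 + q - 1))" by simp
  finally have "(Q - Y1 * Y2) * cmod (y1 * y2 - 1) \<le> (Y1 * Y2 - 1) * cmod (y1 * y2 + q - 1)"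
    by (rule mult_left_le_imp_le) (simp add: assms(1))
  then show ?thesis by (simp add: in_disc_def Q_def)
qed

text \<open>This is \<open>|t| \<le> 1 / Q\<close>. The point \<open>y = 0\<close> lies on the
  boundary, since there \<open>t = -1 / (q - 1)\<close>.\<close>

definition small_trans :: "complex \<Rightarrow> complex \<Rightarrow> bool" where
  "small_trans q y \<longleftrightarrow> cmod (q - 1) * cmod (y - 1) \<le> cmod (y + q - 1)"

text \<open>The parameter \<open>2 * Q / (Q + 1)\<close> belongs to the radius \<open>1 / Q\<close>:
  the two sides of \<open>in_disc\<close> then share the positive factor
  \<open>(Q - 1) / (Q + 1)\<close>.\<close>

lemma small_trans_if_in_disc:
  assumes "1 < cmod (q - 1)" "in_disc q (2 * cmod (q - 1) / (cmod (q - 1) + 1)) y"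
  shows "small_trans q y"
proof -
  define Q where "Q = cmod (q - 1)"
  have Q: "1 < Q" using assms by (simp add: Q_def)
  have "Q - 2 * Q / (Q + 1) = (Q - 1) / (Q + 1) * Q" "2 * Q / (Q + 1) - 1 = (Q - 1) / (Q + 1)"
    using Q by (simp_all add: field_simps)
  then have "(Q - 1) / (Q + 1) * (Q * cmod (y - 1)) \<le> (Q - 1) / (Q + 1) * cmod (y + q - 1)"
    using assms(2) by (simp add: in_disc_def Q_def mult.assoc)
  moreover have "0 < (Q - 1) / (Q + 1)" using Q by simp
  ultimately show ?thesis unfolding small_trans_def Q_def by (simp only: mult_le_cancel_left_pos)
qed

text \<open>After squaring, the condition reads \<open>g \<le> 0\<close> for a quadratic
  \<open>g\<close> with leading coefficient \<open>Q\<^sup>2 - 1 > 0\<close>. So \<open>g\<close> is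
  convex on the segment from 0 to \<open>y\<close> and nonpositive at both ends.\<close>

lemma small_trans_scale:
  assumes "1 < cmod (q - 1)" "small_trans q y" "0 \<le> \<alpha>" "\<alpha> \<le> 1"
  shows "small_trans q (of_real \<alpha> * y)"
proof -
  define Q where "Q = cmod (q - 1)"
  define g where "g z = Q\<^sup>2 * (cmod (z - 1))\<^sup>2 - (cmod (z + q - 1))\<^sup>2" for z
  have iff: "small_trans q z \<longleftrightarrow> g z \<le> 0" for z
  proof -
    have "small_trans q z \<longleftrightarrow> (Q * cmod (z - 1))\<^sup>2 \<le> (cmod (z + q - 1))\<^sup>2"
      unfolding small_trans_def Q_def by (subst abs_le_square_iff[symmetric]) auto
    then show ?thesis by (simp add: g_def power_mult_distrib)
  qed
  have g0: "g 0 = 0" by (simp add: g_def Q_def)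
  have "g (of_real \<alpha> * y) = \<alpha> * g y + (1 - \<alpha>) * g 0 - (Q\<^sup>2 - 1) * (\<alpha> * (1 - \<alpha>) * (cmod y)\<^sup>2)"
    unfolding g_def cmod_power2 by (simp add: power2_eq_square algebra_simps)
  moreover have "0 \<le> (Q\<^sup>2 - 1) * (\<alpha> * (1 - \<alpha>) * (cmod y)\<^sup>2)"
    using assms by (intro mult_nonneg_nonneg) (auto simp: Q_def intro: one_le_power)
  moreover have "\<alpha> * g y \<le> 0" using assms iff by (simp add: mult_nonneg_nonpos)
  ultimately show ?thesis by (simp add: iff g0)
qed

text \<open>The factor \<open>\<alpha>\<close> accommodates the initial weights: every
  \<open>y\<close> in [0,1] is a multiple of 1, which lies in all these discs when
  \<open>Q > 1\<close>, whereas \<open>y = 0\<close> has \<open>|t| = 1 / Q\<close> and lies outside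
  the first disc.\<close>

definition edge_region :: "complex \<Rightarrow> nat \<Rightarrow> complex \<Rightarrow> bool" where
  "edge_region q k y \<longleftrightarrow> (\<exists>\<alpha>\<in>{0..1}. \<exists>z. y = of_real \<alpha> * z \<and> in_disc q (disc_mult (cmod (q - 1)) ^ k) z)"

lemma disc_mult_ge_one: "1 \<le> Q \<Longrightarrow> 1 \<le> disc_mult Q"
  by (subst disc_mult_def, subst le_divide_eq_1_pos)
    (auto simp: power2_eq_square algebra_simps intro: add_pos_nonneg)

section \<open>Stability of the edge regions for large Q\<close>

locale root_param =
  fixes q :: complex and \<Lambda> :: nat
  assumes Lambda: "2 \<le> \<Lambda>" and large: "(real \<Lambda> - 1) / ln 2 \<le> cmod (q - 1)"
begin

lemma Q_gt_one: "1 < cmod (q - 1)"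
proof -
  have L: "0 < ln (2::real)" "ln (2::real) < 1" using ln_2_bounds by auto
  then have "1 < 1 / ln (2::real)" by simp
  also have "\<dots> \<le> (real \<Lambda> - 1) / ln 2" using Lambda L by (intro divide_right_mono) auto
  finally show ?thesis using large by linarith
qed

lemma q_nonzero: "q \<noteq> 0"
  using Q_gt_one by auto

text \<open>The lower bound on \<open>Q\<close> enters in full strength here, through the largest
  exponent \<open>\<Lambda> - 1\<close>.\<close>

lemma disc_power_bound:
  assumes "k < \<Lambda>"
  shows "disc_mult (cmod (q - 1)) ^ k \<le> 2 * cmod (q - 1) / (cmod (q - 1) + 1)"
proof -
  have "disc_mult (cmod (q - 1)) ^ k \<le> disc_mult (cmod (q - 1)) ^ (\<Lambda> - 1)"
    using assms Q_gt_one disc_mult_ge_one by (intro power_increasing) auto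
  also have "\<dots> \<le> 2 * cmod (q - 1) / (cmod (q - 1) + 1)"
    using Lambda large by (intro disc_mult_power_le) (auto simp: of_nat_diff)
  finally show ?thesis .
qed

lemma disc_bound_less: "2 * cmod (q - 1) / (cmod (q - 1) + 1) < cmod (q - 1)"
  proof -
  have "cmod (q - 1) * 1 < cmod (q - 1) * cmod (q - 1)"
    using Q_gt_one by (intro mult_strict_left_mono) auto
  then show ?thesis using Q_gt_one by (subst pos_divide_less_eq) (simp_all add: algebra_simps)
qed

lemma edge_region_small:
  assumes "edge_region q k y" "k < \<Lambda>"
  shows "small_trans q y"
proof -
  obtain \<alpha> z where z: "y = of_real \<alpha> * z" "0 \<le> \<alpha>" "\<alpha> \<le> 1" "in_disc q (disc_mult (cmod (q - 1)) ^ k) z"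
    using assms(1) by (auto simp: edge_region_def)
  have "small_trans q z"
    using in_disc_mono[OF z(4) disc_power_bound[OF assms(2)]] Q_gt_one by (intro small_trans_if_in_disc)
  then show ?thesis using small_trans_scale[OF Q_gt_one] z by blast
qed

text \<open>Exponents add and the scalings multiply within [0,1]. The assumption
  \<open>k + l < \<Lambda>\<close> keeps the product of the disc parameters below \<open>Q\<close>,
  as \<open>in_disc_mult\<close> demands.\<close>

lemma edge_region_mult:
  assumes "edge_region q k y" "edge_region q l z" "k + l < \<Lambda>"
  shows "edge_region q (k + l) (y * z)"
proof -
  let ?D = "disc_mult (cmod (q - 1))"
  obtain \<alpha> y' where y: "y = of_real \<alpha> * y'" "0 \<le> \<alpha>" "\<alpha> \<le> 1" "in_disc q (?D ^ k) y'"
    using assms(1) by (auto simp: edge_region_def)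
  obtain \<beta> z' where z: "z = of_real \<beta> * z'" "0 \<le> \<beta>" "\<beta> \<le> 1" "in_disc q (?D ^ l) z'"
    using assms(2) by (auto simp: edge_region_def)
  have "1 \<le> ?D" using Q_gt_one disc_mult_ge_one by auto
  then have "in_disc q (?D ^ k * ?D ^ l) (y' * z')"
    using q_nonzero y z disc_power_bound[OF assms(3)] disc_bound_less
    by (intro in_disc_mult) (auto simp: power_add intro: one_le_power)
  moreover have "y * z = of_real (\<alpha> * \<beta>) * (y' * z')" using y z by simp
  moreover have "\<alpha> * \<beta> \<in> {0..1}" using y z by (auto intro: mult_le_one)
  ultimately show ?thesis unfolding edge_region_def power_add by blast
qed

lemma edge_region_real:
  assumes "0 \<le> \<alpha>" "\<alpha> \<le> 1"
  shows "edge_region q k (of_real \<alpha>)"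
  using assms disc_mult_ge_one[of "cmod (q - 1)"] Q_gt_one
  unfolding edge_region_def by (intro bexI[of _ \<alpha>] exI[of _ 1] conjI in_disc_one one_le_power) auto

lemma small_trans_nonzero:
  assumes "small_trans q y"
  shows "y + q - 1 \<noteq> 0"
proof
  assume *: "y + q - 1 = 0"
  then have "cmod (q - 1) * cmod (y - 1) \<le> 0" using assms by (simp add: small_trans_def)
  then have "cmod (y - 1) \<le> 0" using Q_gt_one by (simp only: mult_le_0_iff) linarith
  then show False using * q_nonzero by auto
qed

text \<open>For parallel connections whose capacity reaches \<Lambda>. A zero would mean
  \<open>1 + (q - 1) t1 t2 = 0\<close>, so \<open>|t1 t2| = 1 / Q\<close>, against
  \<open>|t1 t2| \<le> 1 / Q\<^sup>2\<close>.\<close>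

lemma small_trans_parallel_nonzero:
  assumes "small_trans q y" "small_trans q z"
  shows "y * z + q - 1 \<noteq> 0"
proof
  assume "y * z + q - 1 = 0"
  then have "(y + q - 1) * (z + q - 1) = - ((q - 1) * ((y - 1) * (z - 1)))"
    using parallel_transmissivity(2)[of q y z] by (simp add: eq_neg_iff_add_eq_0)
  then have e: "cmod (y + q - 1) * cmod (z + q - 1) = cmod (q - 1) * (cmod (y - 1) * cmod (z - 1))"
    by (metis norm_minus_cancel norm_mult)
  have "cmod (q - 1) * cmod (y - 1) * (cmod (q - 1) * cmod (z - 1)) \<le> cmod (y + q - 1) * cmod (z + q - 1)"
    using assms unfolding small_trans_def by (intro mult_mono) auto
  then have le: "cmod (q - 1) * (cmod (q - 1) * (cmod (y - 1) * cmod (z - 1))) \<le> 1 * (cmod (q - 1) * (cmod (y - 1) * cmod (z - 1)))"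
    unfolding e by (simp add: ac_simps)
  have pos: "0 < cmod (y + q - 1) * cmod (z + q - 1)"
    using small_trans_nonzero assms by simp
  have "cmod (q - 1) \<le> 1" using le pos unfolding e by (simp only: mult_le_cancel_right_pos)
  then show False using Q_gt_one by simp
qed

text \<open>In series the values of \<open>t\<close> multiply, so
  \<open>|t| \<le> 1 / Q\<^sup>2\<close>, the radius of the first disc. A zero of
  \<open>q + u + v\<close> would make that product equal to 1.\<close>

lemma series_region:
  assumes "small_trans q (1 + u)" "small_trans q (1 + v)"
  shows "q + u + v \<noteq> 0" and "edge_region q 1 (1 + u * v / (q + u + v))"
proof -
  define Q where "Q = cmod (q - 1)"
  have Q: "1 < Q" using Q_gt_one by (simp add: Q_def)
  have nz: "q + u \<noteq> 0" "q + v \<noteq> 0"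
    using assms[THEN small_trans_nonzero] by (auto simp: add_ac)
  have s: "Q * cmod u \<le> cmod (q + u)" "Q * cmod v \<le> cmod (q + v)"
    using assms by (simp_all add: small_trans_def Q_def add.commute)
  have le: "Q\<^sup>2 * (cmod u * cmod v) \<le> cmod (q + u) * cmod (q + v)"
    using mult_mono[OF s] Q by (simp add: power2_eq_square ac_simps)
  show nz': "q + u + v \<noteq> 0"
  proof
    assume "q + u + v = 0"
    then have "(q + u) * (q + v) = u * v" by (metis add_eq_0_iff add.commute add.left_commute minus_mult_minus mult.commute)
    then have "cmod (q + u) * cmod (q + v) = cmod u * cmod v" by (metis norm_mult)
    then have "Q\<^sup>2 * (cmod (q + u) * cmod (q + v)) \<le> 1 * (cmod (q + u) * cmod (q + v))" using le by simp
    moreover have "0 < cmod (q + u) * cmod (q + v)" using nz by simp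
    ultimately have "Q\<^sup>2 \<le> 1" by (simp only: mult_le_cancel_right_pos)
    then show False using Q one_less_power[of Q 2] by linarith
  qed
  define w where "w = u * v / (q + u + v)"
  have w: "w * (q + u + v) = u * v" using nz' by (simp add: w_def)
  have qw: "(q + w) * (q + u + v) = (q + u) * (q + v)"
    using w by (simp add: algebra_simps)
  have "(Q\<^sup>2 * cmod w) * cmod (q + u + v) = Q\<^sup>2 * (cmod u * cmod v)"
    by (metis w norm_mult mult.assoc)
  also note le
  also have "cmod (q + u) * cmod (q + v) = cmod (q + w) * cmod (q + u + v)"
    by (metis qw norm_mult)
  finally have k: "Q\<^sup>2 * cmod w \<le> cmod (q + w)" using nz' by simp
  have sp: "Q\<^sup>2 + 1 > 0" by (simp add: add_nonneg_pos)
  have "Q - disc_mult Q = (Q - 1) / (Q\<^sup>2 + 1) * Q\<^sup>2" "disc_mult Q - 1 = (Q - 1) / (Q\<^sup>2 + 1)"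
    using sp by (simp_all add: disc_mult_def divide_simps) (simp_all add: algebra_simps power2_eq_square)
  then have "(Q - disc_mult Q) * cmod w \<le> (disc_mult Q - 1) * cmod (q + w)"
    using mult_left_mono[OF k, of "(Q - 1) / (Q\<^sup>2 + 1)"] Q sp by (simp add: mult.assoc)
  then have "in_disc q (disc_mult Q ^ 1) (1 + w)"
    by (simp add: in_disc_def Q_def add.commute)
  then show "edge_region q 1 (1 + u * v / (q + u + v))"
    unfolding edge_region_def w_def[symmetric] Q_def[symmetric]
    by (intro bexI[of _ 1] exI[of _ "1 + w"]) auto
qed

end

section \<open>Series, parallel and bridge formulas for the Tutte polynomial\<close>

lemma adj_rel_mono: "A \<subseteq> B \<Longrightarrow> adj_rel A ends \<subseteq> adj_rel B ends"
  by (auto simp: adj_rel_def)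

lemma adj_rel_cong: "(\<And>e. e \<in> A \<Longrightarrow> ends e = ends' e) \<Longrightarrow> adj_rel A ends = adj_rel A ends'"
  by (auto simp: adj_rel_def)

lemma num_components_cong:
  "(\<And>e. e \<in> A \<Longrightarrow> ends e = ends' e) \<Longrightarrow> num_components V A ends = num_components V A ends'"
  unfolding num_components_def by (simp cong: adj_rel_cong)

lemma sym_adj_rel_rtrancl: "sym ((adj_rel A ends)\<^sup>*)"
  by (intro sym_rtrancl) (auto simp: sym_def adj_rel_def)

lemma adj_rel_insert_rtrancl_connected:
  assumes "ends e = {a, b}" "(a, b) \<in> (adj_rel A ends)\<^sup>*"
  shows "(adj_rel (insert e A) ends)\<^sup>* = (adj_rel A ends)\<^sup>*"
proof (rule rtrancl_subset)
  show "adj_rel A ends \<subseteq> adj_rel (insert e A) ends" by (rule adj_rel_mono) auto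
  have "(b, a) \<in> (adj_rel A ends)\<^sup>*"
    using assms(2) sym_adj_rel_rtrancl by (metis symD)
  then show "adj_rel (insert e A) ends \<subseteq> (adj_rel A ends)\<^sup>*"
    using assms by (auto simp: adj_rel_def)
qed

lemma num_components_insert_connected:
  assumes "ends e = {a, b}" "(a, b) \<in> (adj_rel A ends)\<^sup>*"
  shows "num_components V (insert e A) ends = num_components V A ends"
  unfolding num_components_def adj_rel_insert_rtrancl_connected[OF assms] ..

lemma num_components_insert_disconnected:
  assumes V: "finite V" "a \<in> V" "b \<in> V" and e: "ends e = {a, b}"
    and nc: "(a, b) \<notin> (adj_rel A ends)\<^sup>*"
  shows "num_components V A ends = Suc (num_components V (insert e A) ends)"
proof -
  let ?R = "(adj_rel A ends)\<^sup>*" and ?S = "(adj_rel (insert e A) ends)\<^sup>*"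
  have symR: "(x, y) \<in> ?R \<Longrightarrow> (y, x) \<in> ?R" for x y
    using sym_adj_rel_rtrancl by (metis symD)
  have RS: "?R \<subseteq> ?S" by (intro rtrancl_mono adj_rel_mono) auto
  have ab: "(a, b) \<in> ?S" "(b, a) \<in> ?S" using e by (auto simp: adj_rel_def)
  \<comment> \<open>A walk needs the new edge at most once, in one of its two directions. Hence the
    classes of \<open>a\<close> and \<open>b\<close> merge and all others stay.\<close>
  have S: "(x, y) \<in> ?S \<longleftrightarrow> (x, y) \<in> ?R \<or> (x, a) \<in> ?R \<and> (b, y) \<in> ?R \<or> (x, b) \<in> ?R \<and> (a, y) \<in> ?R" for x y
  proof
    assume "(x, y) \<in> ?S"
    then show "(x, y) \<in> ?R \<or> (x, a) \<in> ?R \<and> (b, y) \<in> ?R \<or> (x, b) \<in> ?R \<and> (a, y) \<in> ?R"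
    proof induction
      case (step y z)
      have "(y, z) \<in> adj_rel A ends \<or> (y \<in> {a, b} \<and> z \<in> {a, b})"
        using step(2) e by (auto simp: adj_rel_def)
      then show ?case
      proof
        assume "(y, z) \<in> adj_rel A ends"
        then show ?thesis using step(3) by (meson rtrancl.rtrancl_into_rtrancl)
      next
        assume "y \<in> {a, b} \<and> z \<in> {a, b}"
        then show ?thesis using step(3) nc symR
          by (metis insert_iff rtrancl.rtrancl_refl rtrancl_trans singletonD)
      qed
    qed auto
  next
    assume "(x, y) \<in> ?R \<or> (x, a) \<in> ?R \<and> (b, y) \<in> ?R \<or> (x, b) \<in> ?R \<and> (a, y) \<in> ?R"
    then show "(x, y) \<in> ?S" using RS ab by (meson rtrancl_trans subsetD)
  qed
  define f g where "f x = {y\<in>V. (x, y) \<in> ?R}" and "g x = {y\<in>V. (x, y) \<in> ?S}" for x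
  have g: "g x = (if x \<in> f a \<union> f b then f a \<union> f b else f x)" if "x \<in> V" for x
  proof -
    have "g x = {y\<in>V. (x, y) \<in> ?R \<or> (x, a) \<in> ?R \<and> (b, y) \<in> ?R \<or> (x, b) \<in> ?R \<and> (a, y) \<in> ?R}"
      unfolding g_def S ..
    moreover have "\<dots> = (if x \<in> f a \<union> f b then f a \<union> f b else f x)"
      using that nc symR unfolding f_def by (auto dest: rtrancl_trans)
    ultimately show ?thesis by simp
  qed
  have fx: "f x = f c" if "x \<in> f c" "x \<in> V" for x c
    using that symR unfolding f_def by (auto dest: rtrancl_trans)
  have self: "x \<in> f x" if "x \<in> V" for x using that by (simp add: f_def)
  have neq: "f a \<noteq> f b" using self[OF V(3)] nc by (auto simp: f_def)
  have gV: "g ` V = insert (f a \<union> f b) (f ` V - {f a, f b})"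
  proof (intro equalityI subsetI)
    fix C assume "C \<in> g ` V"
    then obtain x where x: "x \<in> V" "C = g x" by auto
    show "C \<in> insert (f a \<union> f b) (f ` V - {f a, f b})"
      using g[OF x(1)] x self[OF x(1)] by (cases "x \<in> f a \<union> f b") auto
  next
    fix C assume "C \<in> insert (f a \<union> f b) (f ` V - {f a, f b})"
    then consider "C = f a \<union> f b" | x where "x \<in> V" "C = f x" "f x \<noteq> f a" "f x \<noteq> f b" by auto
    then show "C \<in> g ` V"
    proof cases
      case 1
      then show ?thesis using g[OF V(2)] self[OF V(2)] V(2) by (metis UnI1 image_eqI)
    next
      case 2
      then have "x \<notin> f a \<union> f b" using fx by auto
      then show ?thesis using 2 g[OF 2(1)] by (metis image_eqI)
    qed
  qed
  have nin: "f a \<union> f b \<notin> f ` V - {f a, f b}"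
  proof
    assume "f a \<union> f b \<in> f ` V - {f a, f b}"
    then obtain x where x: "x \<in> V" "f a \<union> f b = f x" "f x \<noteq> f a" by auto
    then have "a \<in> f x" using self[OF V(2)] by auto
    then show False using fx[of a x] V x by auto
  qed
  have "2 \<le> card (f ` V)"
    using card_mono[of "f ` V" "{f a, f b}"] V neq by auto
  moreover have "card (f ` V - {f a, f b}) = card (f ` V) - 2"
    using V neq by (subst card_Diff_subset) auto
  moreover have "card (g ` V) = Suc (card (f ` V - {f a, f b}))"
    unfolding gV using nin V by (subst card_insert_disjoint) auto
  ultimately show ?thesis unfolding num_components_def f_def g_def by simp
qed

text \<open>Non-reachability is proved below by exhibiting such a closed \<open>X\<close>: an
  isolated vertex, one side of a bridge, or an enlarged component.\<close>

lemma rtrancl_adj_rel_closed: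
  assumes "(x, y) \<in> (adj_rel A ends)\<^sup>*" "x \<in> X" "\<And>e. e \<in> A \<Longrightarrow> ends e \<inter> X \<noteq> {} \<Longrightarrow> ends e \<subseteq> X"
  shows "y \<in> X"
  using assms(1,2)
proof induction
  case (step y z)
  then show ?case using assms(3) unfolding adj_rel_def by blast
qed

lemma num_components_insert_vertex:
  assumes "finite V" "w \<notin> V" "\<And>e. e \<in> A \<Longrightarrow> ends e \<subseteq> V"
  shows "num_components (insert w V) A ends = Suc (num_components V A ends)"
proof -
  let ?R = "(adj_rel A ends)\<^sup>*"
  have w: "(w, y) \<in> ?R \<longleftrightarrow> y = w" for y
    using rtrancl_adj_rel_closed[of w y A ends "{w}"] assms by auto
  have w': "(y, w) \<in> ?R \<longleftrightarrow> y = w" for y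
    using w[of y] sym_adj_rel_rtrancl by (metis symD)
  have "(\<lambda>x. {y\<in>insert w V. (x, y) \<in> ?R}) ` insert w V = insert {w} ((\<lambda>x. {y\<in>V. (x, y) \<in> ?R}) ` V)"
  proof -
    have "{y\<in>insert w V. (x, y) \<in> ?R} = {y\<in>V. (x, y) \<in> ?R}" if "x \<in> V" for x
      using that w' assms(2) by auto
    moreover have "{y\<in>insert w V. (w, y) \<in> ?R} = {w}" using w by auto
    ultimately show ?thesis by (simp cong: image_cong)
  qed
  moreover have "{w} \<notin> (\<lambda>x. {y\<in>V. (x, y) \<in> ?R}) ` V" using assms(2) by auto
  ultimately show ?thesis unfolding num_components_def using assms(1) by simp
qed

section \<open>Deletion-contraction and the parallel and series formulas\<close>

lemma sum_Pow_insert: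
  assumes "finite A" "e \<notin> A"
  shows "(\<Sum>B\<in>Pow (insert e A). h B) = (\<Sum>B\<in>Pow A. h B + h (insert e B))"
proof -
  have "inj_on (insert e) (Pow A)" using assms(2) by (fastforce simp: inj_on_def)
  moreover have "Pow A \<inter> insert e ` Pow A = {}" using assms(2) by auto
  ultimately show ?thesis
    using assms(1) by (simp add: Pow_insert sum.union_disjoint sum.reindex sum.distrib)
qed

text \<open>The Tutte polynomial of the graph with \<open>e\<close> contracted, computed on the original vertex set.\<close>

definition tutte_contract :: "'v set \<Rightarrow> 'e set \<Rightarrow> ('e \<Rightarrow> 'v set) \<Rightarrow> 'e \<Rightarrow> complex \<Rightarrow> ('e \<Rightarrow> complex) \<Rightarrow> complex" where
  "tutte_contract V A ends e q v = (\<Sum>B\<in>Pow A. q ^ num_components V (insert e B) ends * (\<Prod>i\<in>B. v i))"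

lemma prod_insert_subset:
  assumes "finite A" "e \<notin> A" "B \<in> Pow A"
  shows "(\<Prod>i\<in>insert e B. v i) = v e * (\<Prod>i\<in>B. v i)"
  using assms by (subst prod.insert) (auto dest: finite_subset)

lemma tutte_Z_insert:
  assumes "finite A" "e \<notin> A"
  shows "tutte_Z V (insert e A) ends q v = tutte_Z V A ends q v + v e * tutte_contract V A ends e q v"
  unfolding tutte_Z_def tutte_contract_def sum_Pow_insert[OF assms] sum.distrib sum_distrib_left
  using assms by (intro arg_cong2[of _ _ _ _ plus] refl sum.cong) (simp_all add: prod_insert_subset)

lemma tutte_Z_cong:
  assumes "\<And>e. e \<in> A \<Longrightarrow> ends e = ends' e" "\<And>e. e \<in> A \<Longrightarrow> v e = v' e"
  shows "tutte_Z V A ends q v = tutte_Z V A ends' q v'"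
  unfolding tutte_Z_def
  using assms by (intro sum.cong refl arg_cong2[of _ _ _ _ times] arg_cong[of _ _ "power q"] num_components_cong prod.cong) auto

lemma tutte_contract_cong:
  assumes "\<And>i. i \<in> insert e A \<Longrightarrow> ends i = ends' i" "\<And>i. i \<in> A \<Longrightarrow> v i = v' i"
  shows "tutte_contract V A ends e q v = tutte_contract V A ends' e q v'"
  unfolding tutte_contract_def
  using assms by (intro sum.cong refl arg_cong2[of _ _ _ _ times] arg_cong[of _ _ "power q"] num_components_cong prod.cong) auto

text \<open>No edge of \<open>A\<close> leaves \<open>X\<close>, so in every subset of
  \<open>A\<close> the vertices \<open>a\<close> and \<open>b\<close> lie in different components,
  which \<open>e\<close> merges.\<close>

lemma tutte_contract_bridge:
  assumes V: "finite V" "a \<in> V" "b \<in> V" and e: "ends e = {a, b}"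
    and X: "a \<in> X" "b \<notin> X" "\<And>i. i \<in> A \<Longrightarrow> ends i \<inter> X \<noteq> {} \<Longrightarrow> ends i \<subseteq> X"
  shows "tutte_Z V A ends q v = q * tutte_contract V A ends e q v"
proof -
  have "num_components V B ends = Suc (num_components V (insert e B) ends)" if "B \<in> Pow A" for B
  proof (rule num_components_insert_disconnected[OF V, where e = e])
    show "ends e = {a, b}" by fact
    show "(a, b) \<notin> (adj_rel B ends)\<^sup>*"
      using rtrancl_adj_rel_closed[of a b B ends X] X that by auto
  qed
  then show ?thesis
    unfolding tutte_Z_def tutte_contract_def sum_distrib_left by (intro sum.cong) auto
qed

lemma tutte_Z_parallel:
  assumes "finite A" "e \<notin> A" "f \<notin> insert e A" "ends e = {a, b}" "ends f = ends e"
  shows "tutte_Z V (insert f (insert e A)) ends q v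
    = tutte_Z V (insert e A) ends q (v(e := (1 + v e) * (1 + v f) - 1))"
proof -
  have adj: "adj_rel (insert f B) ends = adj_rel (insert e B) ends"
    "adj_rel (insert f (insert e B)) ends = adj_rel (insert e B) ends" for B
    using assms(5) by (auto simp: adj_rel_def)
  \<comment> \<open>Contracting \<open>f\<close> turns \<open>e\<close> into a loop, which
    contributes the factor \<open>1 + v e\<close>.\<close>
  have c: "tutte_contract V (insert e A) ends f q v = (1 + v e) * tutte_contract V A ends e q v"
    unfolding tutte_contract_def num_components_def adj sum_Pow_insert[OF assms(1,2)] insert_absorb2 sum_distrib_left
    using assms by (intro sum.cong refl) (simp add: prod_insert_subset algebra_simps)
  have "tutte_Z V (insert f (insert e A)) ends q v = tutte_Z V A ends q v
     + ((1 + v e) * (1 + v f) - 1) * tutte_contract V A ends e q v"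
    using assms(1,2,3) by (simp add: tutte_Z_insert c algebra_simps)
  also have "\<dots> = tutte_Z V A ends q (v(e := (1 + v e) * (1 + v f) - 1))
     + ((1 + v e) * (1 + v f) - 1) * tutte_contract V A ends e q (v(e := (1 + v e) * (1 + v f) - 1))"
    using assms(2) by (intro arg_cong2[of _ _ _ _ plus] arg_cong2[of _ _ _ _ times] refl
        tutte_Z_cong tutte_contract_cong) auto
  finally show ?thesis using assms(1,2) by (simp add: tutte_Z_insert)
qed

text \<open>A subset with neither half isolates \<open>w\<close> (factor \<open>q\<close>), one with
  exactly one half makes \<open>w\<close> pendant, and one with both halves acts like the
  unsubdivided \<open>e\<close>. Free of division by \<open>q + v e + v f\<close>, the formula also
  serves the bridge case.\<close>

lemma tutte_Z_series:
  assumes V: "finite V" "a \<in> V" "b \<in> V" "w \<notin> V"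
    and A: "finite A" "e \<notin> A" "f \<notin> insert e A" "\<And>i. i \<in> A \<Longrightarrow> ends i \<subseteq> V" "ends e = {a, b}"
  shows "tutte_Z (insert w V) (insert f (insert e A)) (ends(e := {a, w}, f := {w, b})) q v
    = (q + v e + v f) * tutte_Z V A ends q v + v e * v f * tutte_contract V A ends e q v"
proof -
  let ?W = "insert w V"
  define ends' where "ends' = ends(e := {a, w}, f := {w, b})"
  have eq: "ends' i = ends i" if "i \<in> A" for i using that A by (auto simp: ends'_def)
  have ef: "ends' e = {a, w}" "ends' f = {w, b}" using A by (auto simp: ends'_def)
  have wab: "w \<noteq> a" "w \<noteq> b" using V by auto
  have k: "num_components ?W B ends' = Suc (num_components V B ends)"
    "num_components ?W (insert e B) ends' = num_components V B ends"
    "num_components ?W (insert f B) ends' = num_components V B ends"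
    "num_components ?W (insert f (insert e B)) ends' = num_components V (insert e B) ends"
    if B: "B \<in> Pow A" for B
  proof -
    have eqB: "ends' i = ends i" if "i \<in> B" for i using that B eq by auto
    have sub: "ends' i \<subseteq> V" if "i \<in> B" for i using that B eq[of i] A(4)[of i] by auto
    have adjB: "adj_rel B ends' = adj_rel B ends" by (rule adj_rel_cong) (rule eqB)
    have iso: "(w, y) \<notin> (adj_rel B ends')\<^sup>*" if "y \<noteq> w" for y
      using rtrancl_adj_rel_closed[of w y B ends' "{w}"] sub V(4) that by auto
    have iso': "(y, w) \<notin> (adj_rel B ends')\<^sup>*" if "y \<noteq> w" for y
      using iso[OF that] sym_adj_rel_rtrancl by (metis symD)
    show 1: "num_components ?W B ends' = Suc (num_components V B ends)"
      using num_components_insert_vertex[of V w B ends'] V sub num_components_cong[of B ends' ends V] eqB by simp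
    have "num_components ?W B ends' = Suc (num_components ?W (insert e B) ends')"
      by (rule num_components_insert_disconnected[where a=a and b=w])
        (use V wab iso' ef in auto)
    then show 2: "num_components ?W (insert e B) ends' = num_components V B ends" using 1 by simp
    have "num_components ?W B ends' = Suc (num_components ?W (insert f B) ends')"
      by (rule num_components_insert_disconnected[where a=w and b=b])
        (use V wab iso ef in auto)
    then show "num_components ?W (insert f B) ends' = num_components V B ends" using 1 by simp
    have aw: "(a, w) \<in> (adj_rel (insert e B) ends')\<^sup>*" "(w, a) \<in> (adj_rel (insert e B) ends')\<^sup>*"
      using ef by (auto simp: adj_rel_def)
    show "num_components ?W (insert f (insert e B)) ends' = num_components V (insert e B) ends"
    proof (cases "(a, b) \<in> (adj_rel B ends)\<^sup>*")
      case True
      then have "(a, b) \<in> (adj_rel (insert e B) ends')\<^sup>*"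
        using rtrancl_mono[OF adj_rel_mono[of B "insert e B" ends']] adjB by auto
      then have "(w, b) \<in> (adj_rel (insert e B) ends')\<^sup>*" using aw by (meson rtrancl_trans)
      then have "num_components ?W (insert f (insert e B)) ends' = num_components ?W (insert e B) ends'"
        by (intro num_components_insert_connected[where e = f]) (rule ef(2))
      also have "\<dots> = num_components V (insert e B) ends"
        using 2 num_components_insert_connected[OF A(5) True] by simp
      finally show ?thesis .
    next
      case False
      have "(w, b) \<notin> (adj_rel (insert e B) ends')\<^sup>*"
      proof
        assume "(w, b) \<in> (adj_rel (insert e B) ends')\<^sup>*"
        \<comment> \<open>The component of \<open>a\<close> in \<open>B\<close>, enlarged by the
          pendant vertex \<open>w\<close>, is closed under the edges of
          \<open>insert e B\<close>.\<close>
        moreover have "b \<in> {y. y = w \<or> (a, y) \<in> (adj_rel B ends)\<^sup>*}"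
        proof (rule rtrancl_adj_rel_closed)
          show "(w, b) \<in> (adj_rel (insert e B) ends')\<^sup>*" by fact
        next
          fix i assume "i \<in> insert e B" and *: "ends' i \<inter> {y. y = w \<or> (a, y) \<in> (adj_rel B ends)\<^sup>*} \<noteq> {}"
          then consider "i = e" | "i \<in> B" by auto
          then show "ends' i \<subseteq> {y. y = w \<or> (a, y) \<in> (adj_rel B ends)\<^sup>*}"
          proof cases
            case 2
            then obtain u where u: "u \<in> ends i" "(a, u) \<in> (adj_rel B ends)\<^sup>*"
              using * eqB[OF 2] sub[OF 2] V(4) by auto
            then have "(a, y) \<in> (adj_rel B ends)\<^sup>*" if "y \<in> ends i" for y
              using that 2 by (intro rtrancl_into_rtrancl[OF u(2)]) (auto simp: adj_rel_def)
            then show ?thesis using eqB[OF 2] by auto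
          qed (use ef in auto)
        qed auto
        ultimately show False using False wab by auto
      qed
      then have "num_components ?W (insert e B) ends' = Suc (num_components ?W (insert f (insert e B)) ends')"
        using V wab ef by (intro num_components_insert_disconnected[where a=w and b=b]) auto
      moreover have "num_components V B ends = Suc (num_components V (insert e B) ends)"
        using V A False by (intro num_components_insert_disconnected[where a=a and b=b]) auto
      ultimately show ?thesis using 2 by simp
    qed
  qed
  have "tutte_Z ?W (insert f (insert e A)) ends' q v =
    (\<Sum>B\<in>Pow A. q ^ num_components ?W B ends' * (\<Prod>i\<in>B. v i)
      + q ^ num_components ?W (insert e B) ends' * (\<Prod>i\<in>insert e B. v i)
      + (q ^ num_components ?W (insert f B) ends' * (\<Prod>i\<in>insert f B. v i)
      + q ^ num_components ?W (insert f (insert e B)) ends' * (\<Prod>i\<in>insert f (insert e B). v i)))"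
    unfolding tutte_Z_def using A by (simp add: sum_Pow_insert sum.distrib)
  also have "\<dots> = (\<Sum>B\<in>Pow A. (q + v e + v f) * (q ^ num_components V B ends * (\<Prod>i\<in>B. v i))
      + v e * v f * (q ^ num_components V (insert e B) ends * (\<Prod>i\<in>B. v i)))"
  proof (rule sum.cong)
    fix B assume B: "B \<in> Pow A"
    have p: "(\<Prod>i\<in>insert e B. v i) = v e * (\<Prod>i\<in>B. v i)" "(\<Prod>i\<in>insert f B. v i) = v f * (\<Prod>i\<in>B. v i)"
      "(\<Prod>i\<in>insert f (insert e B). v i) = v f * (v e * (\<Prod>i\<in>B. v i))"
      using prod_insert_subset[of A e B v] prod_insert_subset[of A f B v]
        prod_insert_subset[of "insert e A" f "insert e B" v] A B by auto
    show "q ^ num_components ?W B ends' * (\<Prod>i\<in>B. v i)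
      + q ^ num_components ?W (insert e B) ends' * (\<Prod>i\<in>insert e B. v i)
      + (q ^ num_components ?W (insert f B) ends' * (\<Prod>i\<in>insert f B. v i)
      + q ^ num_components ?W (insert f (insert e B)) ends' * (\<Prod>i\<in>insert f (insert e B). v i))
      = (q + v e + v f) * (q ^ num_components V B ends * (\<Prod>i\<in>B. v i))
      + v e * v f * (q ^ num_components V (insert e B) ends * (\<Prod>i\<in>B. v i))"
      unfolding k[OF B] p by (simp add: algebra_simps)
  qed simp
  also have "\<dots> = (q + v e + v f) * tutte_Z V A ends q v + v e * v f * tutte_contract V A ends e q v"
    unfolding tutte_Z_def tutte_contract_def sum.distrib sum_distrib_left ..
  finally show ?thesis unfolding ends'_def .
qed

section \<open>Menger's theorem for edge-disjoint paths\<close>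

definition edge_cut :: "'e set \<Rightarrow> ('e \<Rightarrow> 'v set) \<Rightarrow> 'v set \<Rightarrow> 'e set" where
  "edge_cut E ends X = {e\<in>E. ends e \<inter> X \<noteq> {} \<and> \<not> ends e \<subseteq> X}"

text \<open>The step relation \<open>D\<close> is abstract so that it can be plain adjacency, the
  support of a flow or a residual graph. If the new first vertex already occurs, the path is cut
  back to the suffix starting there.\<close>

lemma reachable_imp_distinct_path:
  assumes "(x, y) \<in> {(u, w). \<exists>e. D u e w}\<^sup>*"
  shows "\<exists>vs es. length vs = length es + 1 \<and> hd vs = x \<and> last vs = y \<and> distinct vs \<and>
    (\<forall>i<length es. D (vs ! i) (es ! i) (vs ! Suc i))"
  using assms
proof (induction rule: converse_rtrancl_induct)
  case base
  show ?case by (intro exI[of _ "[y]"] exI[of _ "[]"]) auto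
next
  case (step x z)
  then obtain e vs es where e: "D x e z" and
    p: "length vs = length es + 1" "hd vs = z" "last vs = y" "distinct vs"
    "\<forall>i<length es. D (vs ! i) (es ! i) (vs ! Suc i)" by blast
  show ?case
  proof (cases "x \<in> set vs")
    case True
    then obtain j where j: "j < length vs" "vs ! j = x" by (auto simp: in_set_conv_nth)
    have "length (drop j vs) = length (drop j es) + 1" using p j by simp
    moreover have "hd (drop j vs) = x" "last (drop j vs) = y" "distinct (drop j vs)"
      using p j by (auto simp: hd_drop_conv_nth)
    moreover have "\<forall>i<length (drop j es). D (drop j vs ! i) (drop j es ! i) (drop j vs ! Suc i)"
      using p(1,5) j by auto
    ultimately show ?thesis by blast
  next
    case False
    have "vs ! 0 = z" using p by (cases vs) auto
    have "\<forall>i<length (e # es). D ((x # vs) ! i) ((e # es) ! i) ((x # vs) ! Suc i)"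
    proof (intro allI impI)
      fix i assume "i < length (e # es)"
      then show "D ((x # vs) ! i) ((e # es) ! i) ((x # vs) ! Suc i)"
        using e p \<open>vs ! 0 = z\<close> by (cases i) auto
    qed
    then show ?thesis using False p
      by (intro exI[of _ "x # vs"] exI[of _ "e # es"]) auto
  qed
qed

lemma distinct_path_edges:
  assumes "length vs = length es + 1" "distinct vs" "\<forall>i<length es. ends (es ! i) = {vs ! i, vs ! Suc i}"
  shows "distinct es"
proof (unfold distinct_conv_nth, intro allI impI)
  fix i j assume ij: "i < length es" "j < length es" "i \<noteq> j"
  have n: "vs ! k = vs ! l \<longleftrightarrow> k = l" if "k \<le> length es" "l \<le> length es" for k l
    using assms that by (intro nth_eq_iff_index_eq) auto
  show "es ! i \<noteq> es ! j"
  proof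
    assume "es ! i = es ! j"
    then have "{vs ! i, vs ! Suc i} = {vs ! j, vs ! Suc j}" using assms(3) ij by metis
    then show False using ij n by (auto simp: doubleton_eq_iff)
  qed
qed

lemma reachable_imp_path:
  assumes "(x, y) \<in> {(u, w). \<exists>e\<in>E. ends e = {u, w}}\<^sup>*"
  shows "\<exists>vs es. is_path V E ends x y vs es"
proof -
  have "(x, y) \<in> {(u, w). \<exists>e. e \<in> E \<and> ends e = {u, w}}\<^sup>*" using assms by (simp add: Bex_def)
  from reachable_imp_distinct_path[OF this] obtain vs es where
    "length vs = length es + 1 \<and> hd vs = x \<and> last vs = y \<and> distinct vs \<and>
    (\<forall>i<length es. es ! i \<in> E \<and> ends (es ! i) = {vs ! i, vs ! Suc i})" by blast
  then show ?thesis unfolding is_path_def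
    by (intro exI[of _ vs] exI[of _ es]) (auto simp: in_set_conv_nth)
qed

section \<open>Unit-capacity flows on an arbitrarily oriented graph\<close>

locale oriented_graph =
  fixes V :: "'v set" and E :: "'e set" and ends :: "'e \<Rightarrow> 'v set" and src tgt :: "'e \<Rightarrow> 'v"
  assumes finV: "finite V" and finE: "finite E"
    and orient: "\<And>e. e \<in> E \<Longrightarrow> ends e = {src e, tgt e}" "\<And>e. e \<in> E \<Longrightarrow> src e \<noteq> tgt e"
    and inV: "\<And>e. e \<in> E \<Longrightarrow> ends e \<subseteq> V"
begin

definition excess :: "('e \<Rightarrow> int) \<Rightarrow> 'v \<Rightarrow> int" where
  "excess f z = (\<Sum>e\<in>E. f e * (of_bool (src e = z) - of_bool (tgt e = z)))"

text \<open>A negative \<open>f e\<close> is flow against the orientation, so each edge carries at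
  most one unit in either direction. The value of the flow is \<open>k\<close>.\<close>

definition unit_flow :: "'v \<Rightarrow> 'v \<Rightarrow> nat \<Rightarrow> ('e \<Rightarrow> int) \<Rightarrow> bool" where
  "unit_flow x y k f \<longleftrightarrow> (\<forall>e\<in>E. f e \<in> {-1..1}) \<and>
     (\<forall>z. excess f z = int k * (of_bool (z = x) - of_bool (z = y)))"

lemma excess_add: "excess (\<lambda>e. f e + g e) z = excess f z + excess g z"
  unfolding excess_def by (simp add: distrib_right sum.distrib)

lemma excess_uminus: "excess (\<lambda>e. - f e) z = - excess f z"
  unfolding excess_def by (simp add: sum_negf)

lemma sum_excess:
  assumes "finite X"
  shows "(\<Sum>z\<in>X. excess f z) = (\<Sum>e\<in>E. f e * (of_bool (src e \<in> X) - of_bool (tgt e \<in> X)))"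
proof -
  have *: "(\<Sum>z\<in>X. of_bool (u = z)) = (of_bool (u \<in> X) :: int)" for u
    using assms by (simp add: of_bool_def sum.delta)
  have "(\<Sum>z\<in>X. excess f z) = (\<Sum>e\<in>E. \<Sum>z\<in>X. f e * (of_bool (src e = z) - of_bool (tgt e = z)))"
    unfolding excess_def by (rule sum.swap)
  then show ?thesis by (simp add: sum_distrib_left[symmetric] sum_subtractf *)
qed

text \<open>Summed over \<open>X\<close>, the excess comes only from the source, while edges inside
  \<open>X\<close> cancel.\<close>

lemma unit_flow_cut:
  assumes "unit_flow x y k f" "x \<in> X" "y \<notin> X" "X \<subseteq> V"
  shows "int k = (\<Sum>e\<in>E. f e * (of_bool (src e \<in> X) - of_bool (tgt e \<in> X)))"
proof -
  have fX: "finite X" using assms(4) finV finite_subset by blast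
  have "(\<Sum>z\<in>X. excess f z) = (\<Sum>z\<in>X. if z = x then int k else 0)"
    using assms by (intro sum.cong) (auto simp: unit_flow_def)
  then show ?thesis using sum_excess[OF fX, of f] fX assms(2) by simp
qed

lemma path_flow:
  assumes "length vs = length es + 1" "hd vs = x" "last vs = y" "distinct vs" "set es \<subseteq> E"
    "\<forall>i<length es. ends (es ! i) = {vs ! i, vs ! Suc i}"
  shows "\<exists>p. (\<forall>e. e \<notin> set es \<longrightarrow> p e = 0) \<and>
    (\<forall>i<length es. p (es ! i) = (if src (es ! i) = vs ! i then 1 else -1)) \<and>
    (\<forall>z. excess p z = of_bool (z = x) - of_bool (z = y))"
  using assms
proof (induction es arbitrary: vs x)
  case Nil
  then obtain u where "vs = [u]" by (auto simp: length_Suc_conv)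
  then show ?case using Nil by (intro exI[of _ "\<lambda>_. 0"]) (auto simp: excess_def)
next
  case (Cons e es)
  from Cons.prems(1,2) obtain ws where vs: "vs = x # ws" and ws: "length ws = length es + 1"
    by (cases vs) auto
  let ?u = "hd ws"
  have wsne: "ws \<noteq> []" using ws by auto
  have ew: "\<forall>i<length es. ends (es ! i) = {ws ! i, ws ! Suc i}"
    using Cons.prems(6) vs by fastforce
  have "\<exists>p. (\<forall>e. e \<notin> set es \<longrightarrow> p e = 0) \<and>
    (\<forall>i<length es. p (es ! i) = (if src (es ! i) = ws ! i then 1 else -1)) \<and>
    (\<forall>z. excess p z = of_bool (z = ?u) - of_bool (z = y))"
    using Cons.prems vs ws wsne ew by (intro Cons.IH) auto
  then obtain p where p: "\<And>e. e \<notin> set es \<Longrightarrow> p e = 0"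
    "\<And>i. i < length es \<Longrightarrow> p (es ! i) = (if src (es ! i) = ws ! i then 1 else -1)"
    "\<And>z. excess p z = of_bool (z = ?u) - of_bool (z = y)" by blast
  have e: "ends e = {x, ?u}" "e \<in> E"
    using Cons.prems(5,6) vs wsne by (auto simp: hd_conv_nth)
  have "distinct (e # es)" using distinct_path_edges Cons.prems by blast
  then have ene: "e \<notin> set es" by simp
  have xu: "x \<noteq> ?u" using Cons.prems(4) vs wsne by auto
  let ?s = "if src e = x then 1 else -1 :: int"
  let ?p = "\<lambda>i. p i + (if i = e then ?s else 0)"
  have "excess (\<lambda>i. if i = e then ?s else 0) z = of_bool (z = x) - of_bool (z = ?u)" for z
  proof -
    have "excess (\<lambda>i. if i = e then ?s else 0) z = ?s * (of_bool (src e = z) - of_bool (tgt e = z))"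
      unfolding excess_def using e(2) finE
      by (subst sum.remove[of _ e]) (auto intro!: sum.neutral)
    moreover have "src e = x \<and> tgt e = ?u \<or> src e = ?u \<and> tgt e = x"
      using orient(1)[OF e(2)] e(1) by (metis doubleton_eq_iff)
    ultimately show ?thesis using xu by auto
  qed
  then have "\<forall>z. excess ?p z = of_bool (z = x) - of_bool (z = y)"
    using p(3) by (simp add: excess_add)
  moreover have "\<forall>i. i \<notin> set (e # es) \<longrightarrow> ?p i = 0" using p(1) by auto
  moreover have "\<forall>i<length (e # es). ?p ((e # es) ! i) = (if src ((e # es) ! i) = vs ! i then 1 else -1)"
  proof (intro allI impI)
    fix i assume i: "i < length (e # es)"
    show "?p ((e # es) ! i) = (if src ((e # es) ! i) = vs ! i then 1 else -1)"
    proof (cases i)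
      case 0
      then show ?thesis using p(1)[OF ene] vs by simp
    next
      case (Suc j)
      then have "es ! j \<noteq> e" using i ene by (auto dest: nth_mem)
      then show ?thesis using Suc i p(2)[of j] vs by simp
    qed
  qed
  ultimately show ?case by (intro exI[of _ ?p] conjI)
qed

text \<open>\<open>Fw\<close> and \<open>Bw\<close> tell which edges may be traversed along and
  against their orientation. Taking \<open>0 < f e\<close> and \<open>f e < 0\<close> walks in the
  support of a flow, \<open>f e \<le> 0\<close> and \<open>0 \<le> f e\<close> in its residual
  graph.\<close>

lemma directed_path:
  assumes "(x, y) \<in> {(u, w). \<exists>e. e \<in> E \<and> (src e = u \<and> tgt e = w \<and> Fw e \<or> tgt e = u \<and> src e = w \<and> Bw e)}\<^sup>*"
  obtains vs es p where "is_path V E ends x y vs es" "\<And>e. e \<notin> set es \<Longrightarrow> p e = (0::int)"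
    "\<And>e. e \<in> set es \<Longrightarrow> p e = 1 \<and> Fw e \<or> p e = -1 \<and> Bw e"
    "\<And>z. excess p z = of_bool (z = x) - of_bool (z = y)"
proof -
  from reachable_imp_distinct_path[OF assms] obtain vs es where
    p: "length vs = length es + 1" "hd vs = x" "last vs = y" "distinct vs" and
    D: "\<And>i. i < length es \<Longrightarrow> es ! i \<in> E \<and> (src (es ! i) = vs ! i \<and> tgt (es ! i) = vs ! Suc i \<and> Fw (es ! i)
      \<or> tgt (es ! i) = vs ! i \<and> src (es ! i) = vs ! Suc i \<and> Bw (es ! i))"
    by blast
  have E: "set es \<subseteq> E" using D by (auto simp: in_set_conv_nth)
  have en: "\<forall>i<length es. ends (es ! i) = {vs ! i, vs ! Suc i}"
    using D orient(1) by (metis insert_commute)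
  from path_flow[OF p E en] obtain pf where pf: "\<And>e. e \<notin> set es \<Longrightarrow> pf e = 0"
    "\<And>i. i < length es \<Longrightarrow> pf (es ! i) = (if src (es ! i) = vs ! i then 1 else -1)"
    "\<And>z. excess pf z = of_bool (z = x) - of_bool (z = y)" by blast
  have "pf e = 1 \<and> Fw e \<or> pf e = -1 \<and> Bw e" if e: "e \<in> set es" for e
  proof -
    obtain i where i: "i < length es" "e = es ! i" using e by (auto simp: in_set_conv_nth)
    then show ?thesis using D[OF i(1)] pf(2)[OF i(1)] orient(2)[of e] by auto
  qed
  moreover have "is_path V E ends x y vs es" using p E en by (simp add: is_path_def)
  ultimately show thesis using that pf by blast
qed

lemma reachable_in_V:
  assumes "(x, y) \<in> {(u, w). \<exists>e. e \<in> E \<and> (src e = u \<and> tgt e = w \<and> Fw e \<or> tgt e = u \<and> src e = w \<and> Bw e)}\<^sup>*"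
    "x \<in> V"
  shows "y \<in> V"
  using assms
proof induction
  case (step y z)
  then show ?case using orient inV by fastforce
qed

text \<open>Paths are peeled off the support one at a time. Flow values on a peeled path are 1 or
  -1, so subtracting it leaves 0 there; later paths stay in the support of the remainder and avoid
  its edges.\<close>

lemma unit_flow_paths:
  assumes "unit_flow x y k f" "x \<in> V"
  shows "\<exists>P. (\<forall>i<k. is_path V E ends x y (fst (P i)) (snd (P i)) \<and> (\<forall>e\<in>set (snd (P i)). f e \<noteq> 0)) \<and>
      (\<forall>i<k. \<forall>j<k. i \<noteq> j \<longrightarrow> set (snd (P i)) \<inter> set (snd (P j)) = {})"
  using assms
proof (induction k arbitrary: f)
  case 0
  then show ?case by auto
next
  case (Suc k)
  let ?R = "{(u, w). \<exists>e. e \<in> E \<and> (src e = u \<and> tgt e = w \<and> 0 < f e \<or> tgt e = u \<and> src e = w \<and> f e < 0)}"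
  \<comment> \<open>Otherwise no flow leaves the set reachable from \<open>x\<close>, although this
    cut must carry \<open>Suc k\<close> units.\<close>
  have reach: "(x, y) \<in> ?R\<^sup>*"
  proof (rule ccontr)
    assume "(x, y) \<notin> ?R\<^sup>*"
    then have "int (Suc k) = (\<Sum>e\<in>E. f e * (of_bool (src e \<in> ?R\<^sup>* `` {x}) - of_bool (tgt e \<in> ?R\<^sup>* `` {x})))"
      using Suc.prems reachable_in_V by (intro unit_flow_cut) auto
    also have "\<dots> \<le> 0"
    proof (rule sum_nonpos)
      fix e assume e: "e \<in> E"
      have "(x, tgt e) \<in> ?R\<^sup>*" if "(x, src e) \<in> ?R\<^sup>*" "0 < f e"
        by (rule rtrancl_into_rtrancl[OF that(1)]) (use that e in auto)
      moreover have "(x, src e) \<in> ?R\<^sup>*" if "(x, tgt e) \<in> ?R\<^sup>*" "f e < 0"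
        by (rule rtrancl_into_rtrancl[OF that(1)]) (use that e in auto)
      ultimately show "f e * (of_bool (src e \<in> ?R\<^sup>* `` {x}) - of_bool (tgt e \<in> ?R\<^sup>* `` {x})) \<le> 0"
        by (cases "f e" "0::int" rule: linorder_cases) (auto simp: of_bool_def)
    qed
    finally show False by simp
  qed
  from directed_path[OF reach] obtain vs es p where
    p: "is_path V E ends x y vs es" "\<And>e. e \<notin> set es \<Longrightarrow> p e = (0::int)"
    "\<And>e. e \<in> set es \<Longrightarrow> p e = 1 \<and> 0 < f e \<or> p e = -1 \<and> f e < 0"
    "\<And>z. excess p z = of_bool (z = x) - of_bool (z = y)" by metis
  define g where "g e = f e + (- p e)" for e
  have es: "set es \<subseteq> E" using p(1) by (simp add: is_path_def)
  have f1: "\<And>e. e \<in> E \<Longrightarrow> - 1 \<le> f e \<and> f e \<le> 1" using Suc.prems(1) by (auto simp: unit_flow_def)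
  have g0: "g e = 0" if "e \<in> set es" for e
    using p(3)[OF that] f1[of e] es that by (auto simp: g_def)
  have g1: "g e = f e" if "e \<notin> set es" for e using p(2)[OF that] by (simp add: g_def)
  have "unit_flow x y k g"
    unfolding unit_flow_def
  proof (intro conjI ballI allI)
    fix e assume "e \<in> E"
    then show "g e \<in> {-1..1}" using g0[of e] g1[of e] f1[of e] by (cases "e \<in> set es") auto
  next
    fix z
    have "excess g z = excess f z - excess p z"
      unfolding g_def excess_add excess_uminus by simp
    also have "\<dots> = int (Suc k) * (of_bool (z = x) - of_bool (z = y)) - (of_bool (z = x) - of_bool (z = y))"
      using Suc.prems(1) p(4) by (simp only: unit_flow_def)
    also have "\<dots> = int k * (of_bool (z = x) - of_bool (z = y))" by (simp add: left_diff_distrib distrib_right)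
    finally show "excess g z = int k * (of_bool (z = x) - of_bool (z = y))" .
  qed
  from Suc.IH[OF this Suc.prems(2)] obtain P where
    P: "\<And>i. i < k \<Longrightarrow> is_path V E ends x y (fst (P i)) (snd (P i))"
    "\<And>i e. i < k \<Longrightarrow> e \<in> set (snd (P i)) \<Longrightarrow> g e \<noteq> 0"
    "\<And>i j. i < k \<Longrightarrow> j < k \<Longrightarrow> i \<noteq> j \<Longrightarrow> set (snd (P i)) \<inter> set (snd (P j)) = {}" by blast
  have disj: "set (snd (P i)) \<inter> set es = {}" if "i < k" for i using P(2)[OF that] g0 by blast
  have fP: "f e \<noteq> 0" if "i < k" "e \<in> set (snd (P i))" for i e
    using P(2)[OF that] g0[of e] g1[of e] by (cases "e \<in> set es") auto
  have fe: "f e \<noteq> 0" if "e \<in> set es" for e using p(3)[OF that] by auto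
  show ?case
    using P(1,3) p(1) disj fP fe
    by (intro exI[of _ "P(k := (vs, es))"]) (auto simp: less_Suc_eq Int_commute)
qed

text \<open>A flow of maximal value exists because values are bounded by the number of edges. With
  \<open>X\<close> the set reachable from \<open>x\<close> in the residual graph, each cut edge
  carries one unit out of \<open>X\<close>, so the cut has \<open>k\<close> edges.\<close>

lemma max_flow_min_cut:
  assumes "x \<in> V" "y \<in> V" "x \<noteq> y"
  obtains k f X where "unit_flow x y k f" "x \<in> X" "y \<notin> X" "card (edge_cut E ends X) = k"
proof -
  let ?P = "\<lambda>k. \<exists>f. unit_flow x y k f"
  have 0: "?P 0" by (intro exI[of _ "\<lambda>_. 0"]) (simp add: unit_flow_def excess_def)
  have bound: "k \<le> card E" if k: "?P k" for k
  proof -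
    obtain f where f: "unit_flow x y k f" using k by blast
    have "int k = (\<Sum>e\<in>E. f e * (of_bool (src e \<in> {x}) - of_bool (tgt e \<in> {x})))"
      using unit_flow_cut[OF f, of "{x}"] assms by auto
    also have "\<dots> \<le> (\<Sum>e\<in>E. 1)"
      using f by (intro sum_mono) (auto simp: unit_flow_def of_bool_def)
    finally show ?thesis by simp
  qed
  obtain k where k: "?P k" "\<And>l. ?P l \<Longrightarrow> l \<le> k"
    using GreatestI_nat[of ?P 0 "card E"] Greatest_le_nat[of ?P _ "card E"] 0 bound by metis
  obtain f where f: "unit_flow x y k f" using k(1) by blast
  \<comment> \<open>Flow values are integers between -1 and 1, so one more unit fits along the
    orientation iff \<open>f e \<le> 0\<close>, and against it iff
    \<open>0 \<le> f e\<close>.\<close>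
  let ?R = "{(u, w). \<exists>e. e \<in> E \<and> (src e = u \<and> tgt e = w \<and> f e \<le> 0 \<or> tgt e = u \<and> src e = w \<and> 0 \<le> f e)}"
  let ?X = "?R\<^sup>* `` {x}"
  have y: "y \<notin> ?X"
  proof
    assume "y \<in> ?X"
    then have "(x, y) \<in> ?R\<^sup>*" by simp
    from directed_path[OF this] obtain vs es p where
      p: "is_path V E ends x y vs es" "\<And>e. e \<notin> set es \<Longrightarrow> p e = (0::int)"
      "\<And>e. e \<in> set es \<Longrightarrow> p e = 1 \<and> f e \<le> 0 \<or> p e = -1 \<and> 0 \<le> f e"
      "\<And>z. excess p z = of_bool (z = x) - of_bool (z = y)" by metis
    have "unit_flow x y (Suc k) (\<lambda>e. f e + p e)"
      unfolding unit_flow_def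
    proof (intro conjI ballI allI)
      fix e assume "e \<in> E"
      then have "- 1 \<le> f e \<and> f e \<le> 1" using f by (auto simp: unit_flow_def)
      then show "f e + p e \<in> {-1..1}" using p(2)[of e] p(3)[of e] by (cases "e \<in> set es") auto
    next
      fix z
      show "excess (\<lambda>e. f e + p e) z = int (Suc k) * (of_bool (z = x) - of_bool (z = y))"
      proof -
        have "excess f z + excess p z = int k * (of_bool (z = x) - of_bool (z = y)) + (of_bool (z = x) - of_bool (z = y))"
          using f p(4) by (simp only: unit_flow_def)
        then show ?thesis unfolding excess_add by (simp add: distrib_right)
      qed
    qed
    then have "Suc k \<le> k" using k(2) by blast
    then show False by simp
  qed
  have xX: "x \<in> ?X" by simp
  have "int k = (\<Sum>e\<in>E. f e * (of_bool (src e \<in> ?X) - of_bool (tgt e \<in> ?X)))"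
    using y assms(1) reachable_in_V by (intro unit_flow_cut[OF f xX]) auto
  also have "\<dots> = (\<Sum>e\<in>E. of_bool (e \<in> edge_cut E ends ?X))"
  proof (rule sum.cong)
    fix e assume e: "e \<in> E"
    have fe: "- 1 \<le> f e \<and> f e \<le> 1" using f e by (auto simp: unit_flow_def)
    have *: "(x, tgt e) \<in> ?R\<^sup>*" if "(x, src e) \<in> ?R\<^sup>*" "f e \<le> 0"
      by (rule rtrancl_into_rtrancl[OF that(1)]) (use that e in auto)
    have **: "(x, src e) \<in> ?R\<^sup>*" if "(x, tgt e) \<in> ?R\<^sup>*" "0 \<le> f e"
      by (rule rtrancl_into_rtrancl[OF that(1)]) (use that e in auto)
    have cut: "e \<in> edge_cut E ends ?X \<longleftrightarrow> (src e \<in> ?X) \<noteq> (tgt e \<in> ?X)"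
      unfolding edge_cut_def orient(1)[OF e] using e by (auto simp: orient(1))
    have "f e = 1" if "src e \<in> ?X" "tgt e \<notin> ?X" using * that fe by (cases "f e \<le> 0") auto
    moreover have "f e = -1" if "tgt e \<in> ?X" "src e \<notin> ?X" using ** that fe by (cases "0 \<le> f e") auto
    ultimately show "f e * (of_bool (src e \<in> ?X) - of_bool (tgt e \<in> ?X)) = of_bool (e \<in> edge_cut E ends ?X)"
      unfolding cut by (cases "src e \<in> ?X"; cases "tgt e \<in> ?X") (simp_all only: of_bool_eq, simp_all)
  qed simp
  also have "\<dots> = int (card (edge_cut E ends ?X))"
    using finE by (simp add: sum.If_cases of_bool_def edge_cut_def Int_def conj_commute cong: conj_cong)
  finally have "card (edge_cut E ends ?X) = k" by simp
  then show thesis using that f xX y by blast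
qed

end

section \<open>Edge-disjoint paths versus cuts\<close>

lemma menger:
  assumes "multigraph V E ends" "loopless V E ends" "x \<in> V" "y \<in> V" "x \<noteq> y"
  obtains k P X where "\<And>i. i < k \<Longrightarrow> is_path V E ends x y (fst (P i)) (snd (P i))"
    "\<And>i j. i < k \<Longrightarrow> j < k \<Longrightarrow> i \<noteq> j \<Longrightarrow> set (snd (P i)) \<inter> set (snd (P j)) = {}"
    "x \<in> X" "y \<notin> X" "card (edge_cut E ends X) = (k::nat)"
proof -
  have "\<forall>e\<in>E. \<exists>p. ends e = {fst p, snd p} \<and> fst p \<noteq> snd p"
    using assms(2) by (fastforce simp: loopless_def card_2_iff)
  then obtain h where h: "\<And>e. e \<in> E \<Longrightarrow> ends e = {fst (h e), snd (h e)} \<and> fst (h e) \<noteq> snd (h e)"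
    by metis
  interpret oriented_graph V E ends "fst \<circ> h" "snd \<circ> h"
    using assms(1) h by unfold_locales (auto simp: multigraph_def)
  obtain k f X where c: "unit_flow x y k f" "x \<in> X" "y \<notin> X" "card (edge_cut E ends X) = k"
    using max_flow_min_cut assms by metis
  from unit_flow_paths[OF c(1) assms(3)] obtain P where
    "\<And>i. i < k \<Longrightarrow> is_path V E ends x y (fst (P i)) (snd (P i))"
    "\<And>i j. i < k \<Longrightarrow> j < k \<Longrightarrow> i \<noteq> j \<Longrightarrow> set (snd (P i)) \<inter> set (snd (P j)) = {}" by blast
  then show thesis using c(2-4) by (rule that)
qed

text \<open>The maximum is over a finite set: since \<open>x \<noteq> y\<close>, each path has a
  first edge, and disjoint paths have distinct first edges.\<close>

lemma local_edge_conn_paths_le: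
  assumes "finite E" "x \<noteq> y"
    "\<And>i. i < k \<Longrightarrow> is_path V E ends x y (fst (P i)) (snd (P i))"
    "\<And>i j. i < k \<Longrightarrow> j < k \<Longrightarrow> i \<noteq> j \<Longrightarrow> set (snd (P i)) \<inter> set (snd (P j)) = {}"
  shows "k \<le> local_edge_conn V E ends x y"
proof -
  let ?S = "{k. \<exists>P :: nat \<Rightarrow> 'b list \<times> 'a list.
      (\<forall>i<k. is_path V E ends x y (fst (P i)) (snd (P i))) \<and>
      (\<forall>i<k. \<forall>j<k. i \<noteq> j \<longrightarrow> set (snd (P i)) \<inter> set (snd (P j)) = {})}"
  have "l \<le> card E" if l: "l \<in> ?S" for l
  proof -
    obtain P :: "nat \<Rightarrow> 'b list \<times> 'a list" where P: "\<And>i. i < l \<Longrightarrow> is_path V E ends x y (fst (P i)) (snd (P i))"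
      "\<And>i j. i < l \<Longrightarrow> j < l \<Longrightarrow> i \<noteq> j \<Longrightarrow> set (snd (P i)) \<inter> set (snd (P j)) = {}"
      using l by blast
    have ne: "snd (P i) \<noteq> []" if "i < l" for i
    proof
      assume "snd (P i) = []"
      then have "length (fst (P i)) = 1" "hd (fst (P i)) = x" "last (fst (P i)) = y"
        using P(1)[OF that] by (auto simp: is_path_def)
      then show False using assms(2) by (auto simp: length_Suc_conv)
    qed
    have h: "hd (snd (P i)) \<in> set (snd (P i))" if "i < l" for i using ne[OF that] by simp
    have "inj_on (\<lambda>i. hd (snd (P i))) {..<l}"
    proof (rule inj_onI, rule ccontr)
      fix i j assume ij: "i \<in> {..<l}" "j \<in> {..<l}" "hd (snd (P i)) = hd (snd (P j))" "i \<noteq> j"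
      then show False using P(2)[of i j] h[of i] h[of j] by auto
    qed
    moreover have "(\<lambda>i. hd (snd (P i))) ` {..<l} \<subseteq> E"
      using P(1) h unfolding is_path_def by blast
    ultimately show ?thesis using card_inj_on_le[of "\<lambda>i. hd (snd (P i))" "{..<l}" E] assms(1) by simp
  qed
  then have "finite ?S" by (intro finite_subset[of ?S "{..card E}"]) auto
  moreover have "k \<in> ?S" using assms(3,4) by (intro CollectI exI[of _ P]) auto
  ultimately show ?thesis unfolding local_edge_conn_def by (rule Max_ge)
qed

lemma local_edge_conn_le_maxmaxflow:
  assumes "finite V" "x \<in> V" "y \<in> V" "x \<noteq> y"
  shows "local_edge_conn V E ends x y \<le> maxmaxflow V E ends"
proof -
  have "2 \<le> card V" using card_mono[of V "{x, y}"] assms by auto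
  moreover have "{local_edge_conn V E ends x y | x y. x \<in> V \<and> y \<in> V \<and> x \<noteq> y}
      \<subseteq> (\<lambda>(x, y). local_edge_conn V E ends x y) ` (V \<times> V)" by auto
  then have "finite {local_edge_conn V E ends x y | x y. x \<in> V \<and> y \<in> V \<and> x \<noteq> y}"
    using assms(1) by (meson finite_SigmaI finite_imageI finite_subset)
  ultimately show ?thesis unfolding maxmaxflow_def using assms by (auto intro!: Max_ge)
qed

lemma maxmaxflow_cut:
  assumes "multigraph V E ends" "loopless V E ends" "x \<in> V" "y \<in> V" "x \<noteq> y"
  obtains X where "x \<in> X" "y \<notin> X" "card (edge_cut E ends X) \<le> maxmaxflow V E ends"
proof -
  obtain k P X where m: "\<And>i. i < k \<Longrightarrow> is_path V E ends x y (fst (P i)) (snd (P i))"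
    "\<And>i j. i < k \<Longrightarrow> j < k \<Longrightarrow> i \<noteq> j \<Longrightarrow> set (snd (P i)) \<inter> set (snd (P j)) = {}"
    "x \<in> X" "y \<notin> X" "card (edge_cut E ends X) = (k::nat)"
    using menger[OF assms] by blast
  have "k \<le> local_edge_conn V E ends x y"
    using assms m by (intro local_edge_conn_paths_le) (auto simp: multigraph_def)
  then show thesis
    using that m local_edge_conn_le_maxmaxflow[of V x y E ends] assms by (auto simp: multigraph_def)
qed

section \<open>Reduction of series-parallel graphs\<close>

lemma series_parallel_simple:
  assumes "series_parallel V E ends"
  shows "multigraph V E ends \<and> loopless V E ends"
  using assms
proof induction
  case (sp_forest V E ends)
  then show ?case by (simp add: forest_def)
next
  case (sp_series V E ends e a b w f)
  then have "a \<in> V" "b \<in> V" "w \<noteq> a" "w \<noteq> b" unfolding multigraph_def by auto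
  then show ?case using sp_series unfolding multigraph_def loopless_def
    by (auto simp: subset_insertI2)
next
  case (sp_parallel V E ends e f)
  then show ?case unfolding multigraph_def loopless_def by auto
qed

text \<open>The maxmaxflow bound rephrased through cuts with capacities, a form that passes through
  series and parallel reductions.\<close>

definition separated :: "'v set \<Rightarrow> 'e set \<Rightarrow> ('e \<Rightarrow> 'v set) \<Rightarrow> ('e \<Rightarrow> nat) \<Rightarrow> nat \<Rightarrow> bool" where
  "separated V E ends c \<Lambda> \<longleftrightarrow>
    (\<forall>x\<in>V. \<forall>y\<in>V. x \<noteq> y \<longrightarrow> (\<exists>X. x \<in> X \<and> y \<notin> X \<and> sum c (edge_cut E ends X) \<le> \<Lambda>))"

text \<open>A cut between the ends of \<open>e\<close> contains \<open>e\<close>. So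
  \<open>c e \<le> \<Lambda>\<close>, and equality leaves no capacity for the rest of the
  cut.\<close>

lemma separated_edge:
  assumes "separated V E ends c \<Lambda>" "multigraph V E ends" "loopless V E ends" "e \<in> E" "ends e = {a, b}"
  obtains X where "a \<in> X" "b \<notin> X" "e \<in> edge_cut E ends X" "sum c (edge_cut E ends X) \<le> \<Lambda>"
    "c e + sum c (edge_cut E ends X - {e}) \<le> \<Lambda>"
proof -
  have "card (ends e) = 2" using assms(3,4) by (simp add: loopless_def)
  then have "a \<noteq> b" using assms(5) by auto
  moreover have "a \<in> V" "b \<in> V" using assms(2,4,5) unfolding multigraph_def by auto
  ultimately obtain X where X: "a \<in> X" "b \<notin> X" "sum c (edge_cut E ends X) \<le> \<Lambda>"
    using assms(1) unfolding separated_def by blast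
  have e: "e \<in> edge_cut E ends X" using X assms(4,5) by (auto simp: edge_cut_def)
  have "finite (edge_cut E ends X)" using assms(2) by (simp add: edge_cut_def multigraph_def)
  then have "sum c (edge_cut E ends X) = c e + sum c (edge_cut E ends X - {e})"
    using e by (rule sum.remove)
  then show thesis using that X e by metis
qed

text \<open>\<open>X\<close> is what \<open>a\<close> reaches without \<open>e\<close>; a path from
  \<open>a\<close> to \<open>b\<close> avoiding \<open>e\<close> would close up to a cycle.\<close>

lemma forest_bridge:
  assumes "forest V (insert e E) ends" "e \<notin> E"
  obtains a b X where "ends e = {a, b}" "a \<in> V" "b \<in> V" "a \<in> X" "b \<notin> X"
    "\<And>i. i \<in> E \<Longrightarrow> ends i \<inter> X \<noteq> {} \<Longrightarrow> ends i \<subseteq> X"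
proof -
  have "card (ends e) = 2" using assms(1) by (simp add: forest_def loopless_def)
  then obtain a b where ab: "ends e = {a, b}" "a \<noteq> b" by (auto simp: card_2_iff)
  let ?R = "{(u, w). \<exists>i\<in>E. ends i = {u, w}}\<^sup>*"
  have "(a, b) \<notin> ?R"
  proof
    assume "(a, b) \<in> ?R"
    then obtain vs es where p: "is_path V E ends a b vs es"
      using reachable_imp_path[of a b E ends V] by auto
    have len: "length vs = length es + 1" and ne: "vs \<noteq> []" using p by (auto simp: is_path_def)
    have nth: "(vs @ [a]) ! i = vs ! i" if "i \<le> length es" for i
      using that len by (simp add: nth_append)
    have last: "vs ! length es = b" "(vs @ [a]) ! Suc (length es) = a"
      using p len ne by (auto simp: is_path_def last_conv_nth nth_append)
    have "is_cycle V (insert e E) ends (vs @ [a]) (es @ [e])"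
      unfolding is_cycle_def
    proof (intro conjI allI impI)
      show "distinct (es @ [e])"
        using p distinct_path_edges[of vs es ends] assms(2) by (auto simp: is_path_def)
      fix i assume i: "i < length (es @ [e])"
      show "ends ((es @ [e]) ! i) = {(vs @ [a]) ! i, (vs @ [a]) ! Suc i}"
      proof (cases "i < length es")
        case True
        then show ?thesis using p nth[of i] nth[of "Suc i"] by (simp add: is_path_def nth_append)
      next
        case False
        then have "i = length es" using i by simp
        then show ?thesis using nth[of i] last ab(1) by (auto simp: nth_append)
      qed
    qed (use p ne in \<open>auto simp: is_path_def\<close>)
    then show False using assms(1) by (auto simp: forest_def)
  qed
  moreover have "ends i \<subseteq> ?R `` {a}" if i: "i \<in> E" "ends i \<inter> ?R `` {a} \<noteq> {}" for i
  proof -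
    have "card (ends i) = 2" using assms(1) i by (simp add: forest_def loopless_def)
    then obtain u w where uw: "ends i = {u, w}" by (auto simp: card_2_iff)
    then have st: "(u, w) \<in> {(u, w). \<exists>i\<in>E. ends i = {u, w}}" "(w, u) \<in> {(u, w). \<exists>i\<in>E. ends i = {u, w}}"
      using i by auto
    have "(a, u) \<in> ?R \<or> (a, w) \<in> ?R" using i uw by auto
    then have "(a, u) \<in> ?R \<and> (a, w) \<in> ?R" using st by (meson rtrancl_into_rtrancl)
    then show ?thesis using uw by auto
  qed
  moreover have "a \<in> V" "b \<in> V" using assms(1) ab unfolding forest_def multigraph_def by auto
  ultimately show thesis using that[of a b "?R `` {a}"] ab by auto
qed

lemma forest_subset:
  assumes "forest V E ends" "E' \<subseteq> E"
  shows "forest V E' ends"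
  using assms unfolding forest_def multigraph_def loopless_def is_cycle_def
  by (meson finite_subset subset_iff subset_trans)

lemma tutte_Z_no_edges:
  assumes "finite V"
  shows "tutte_Z V {} ends q v = q ^ card V"
proof -
  have "(\<lambda>x. {y\<in>V. (x, y) \<in> (adj_rel {} ends)\<^sup>*}) ` V = (\<lambda>x. {x}) ` V"
    by (intro image_cong) (auto simp: adj_rel_def)
  then have "num_components V {} ends = card V"
    unfolding num_components_def by (simp add: card_image)
  then show ?thesis by (simp add: tutte_Z_def)
qed

text \<open>Each edge is a bridge, so adding it replaces a factor \<open>q\<close> by
  \<open>q + v e\<close>.\<close>

lemma tutte_Z_forest_nonzero:
  assumes "finite E" "forest V E ends" "q \<noteq> 0" "\<And>e. e \<in> E \<Longrightarrow> q + v e \<noteq> 0"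
  shows "tutte_Z V E ends q v \<noteq> 0"
  using assms
proof (induction E rule: finite_induct)
  case empty
  then show ?case by (simp add: tutte_Z_no_edges forest_def multigraph_def)
next
  case (insert e E)
  have V: "finite V" using insert.prems by (simp add: forest_def multigraph_def)
  have IH: "tutte_Z V E ends q v \<noteq> 0"
    using insert forest_subset[of V "insert e E" ends E] by auto
  obtain a b X where "ends e = {a, b}" "a \<in> V" "b \<in> V" "a \<in> X" "b \<notin> X"
    "\<And>i. i \<in> E \<Longrightarrow> ends i \<inter> X \<noteq> {} \<Longrightarrow> ends i \<subseteq> X"
    using forest_bridge[OF insert.prems(1) insert.hyps(2)] by metis
  then have br: "tutte_Z V E ends q v = q * tutte_contract V E ends e q v"
    using V by (intro tutte_contract_bridge[of V a b]) auto
  have "tutte_Z V (insert e E) ends q v = (q + v e) * tutte_contract V E ends e q v"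
    using insert.hyps by (simp add: tutte_Z_insert br algebra_simps)
  then show ?case using IH br insert.prems(3)[of e] by auto
qed

section \<open>Induction over series and parallel operations\<close>

context root_param
begin

text \<open>An edge of capacity \<open>\<Lambda>\<close> must be a bridge, so its weight never enters a parallel connection.\<close>

definition good_edge :: "nat \<Rightarrow> complex \<Rightarrow> bool" where
  "good_edge k u \<longleftrightarrow> 1 \<le> k \<and> q + u \<noteq> 0 \<and> (k < \<Lambda> \<longrightarrow> edge_region q k (1 + u))"

lemma good_edge_small: "good_edge k u \<Longrightarrow> k < \<Lambda> \<Longrightarrow> small_trans q (1 + u)"
  using edge_region_small by (auto simp: good_edge_def)

lemma good_edge_region: "1 \<le> k \<Longrightarrow> k < \<Lambda> \<Longrightarrow> edge_region q k (1 + u) \<Longrightarrow> good_edge k u"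
  using small_trans_nonzero[OF edge_region_small[of k "1 + u"]] by (simp add: good_edge_def add_ac)

text \<open>Capacities are at least 1, so both lie below \<Lambda> and both edges have regions. If
  the sum equals \<Lambda>, only the nonvanishing has to survive.\<close>

lemma good_edge_parallel:
  assumes "good_edge k u" "good_edge l v" "k + l \<le> \<Lambda>"
  shows "good_edge (k + l) ((1 + u) * (1 + v) - 1)"
proof -
  have kl: "1 \<le> k" "1 \<le> l" "k < \<Lambda>" "l < \<Lambda>" using assms by (auto simp: good_edge_def)
  have "(1 + u) * (1 + v) + q - 1 \<noteq> 0"
    using kl assms good_edge_small by (intro small_trans_parallel_nonzero) auto
  then have "q + ((1 + u) * (1 + v) - 1) \<noteq> 0" by (simp add: algebra_simps)
  moreover have "edge_region q (k + l) ((1 + u) * (1 + v))" if "k + l < \<Lambda>"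
    using kl assms that by (intro edge_region_mult) (auto simp: good_edge_def)
  ultimately show ?thesis using kl by (simp add: good_edge_def)
qed

text \<open>The induction undoes the last operation. \<open>c\<close> and \<open>v\<close> are
  arbitrary because the smaller graph carries new capacities and effective weights.\<close>

lemma tutte_Z_nonzero:
  assumes "series_parallel V E ends" "\<And>e. e \<in> E \<Longrightarrow> good_edge (c e) (v e)" "separated V E ends c \<Lambda>"
  shows "tutte_Z V E ends q v \<noteq> 0"
  using assms
proof (induction arbitrary: c v rule: series_parallel.induct)
  case (sp_forest V E ends)
  then show ?case using q_nonzero
    by (intro tutte_Z_forest_nonzero) (auto simp: forest_def multigraph_def good_edge_def)
next
  case (sp_parallel V E ends e f)
  have G: "multigraph V E ends" "loopless V E ends"
    using series_parallel_simple[OF sp_parallel.hyps(1)] by auto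
  define A where "A = E - {e}"
  have A: "E = insert e A" "finite A" "e \<notin> A" "f \<notin> insert e A"
    using sp_parallel.hyps G by (auto simp: A_def multigraph_def)
  obtain a b where ab: "ends e = {a, b}" using G sp_parallel.hyps(2) by (auto simp: loopless_def card_2_iff)
  let ?n = "ends(f := ends e)"
  have ne: "?n f = ends e" "?n e = ends e" using sp_parallel.hyps by auto
  define c' where "c' = c(e := c e + c f)"
  define v' where "v' = v(e := (1 + v e) * (1 + v f) - 1)"
  \<comment> \<open>The edges \<open>e\<close> and \<open>f\<close> cross the same cuts, so adding
    the capacity of \<open>f\<close> to that of \<open>e\<close> preserves every cut
    capacity.\<close>
  have cut: "sum c (edge_cut (insert f E) ?n X) = sum c' (edge_cut E ends X)" for X
  proof -
    have fin: "finite (edge_cut A ends X)" and nin: "e \<notin> edge_cut A ends X" "f \<notin> insert e (edge_cut A ends X)"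
      using A by (auto simp: edge_cut_def)
    have cA: "edge_cut A ?n X = edge_cut A ends X" using A by (auto simp: edge_cut_def)
    have c'A: "sum c' (edge_cut A ends X) = sum c (edge_cut A ends X)"
      using nin by (intro sum.cong) (auto simp: c'_def)
    have ins: "edge_cut (insert i B) m X = (if m i \<inter> X \<noteq> {} \<and> \<not> m i \<subseteq> X then insert i (edge_cut B m X) else edge_cut B m X)"
      for i B and m :: "'b \<Rightarrow> 'a set"
      by (auto simp: edge_cut_def)
    show ?thesis unfolding A(1) ins ne cA using fin nin by (simp add: c'A) (simp add: c'_def)
  qed
  have sep: "separated V E ends c' \<Lambda>"
    using sp_parallel.prems(2) unfolding separated_def cut .
  have "good_edge (c' i) (v' i)" if "i \<in> E" for i
  proof (cases "i = e")
    case True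
    obtain X where "c' e + sum c' (edge_cut E ends X - {e}) \<le> \<Lambda>"
      using separated_edge[OF sep G sp_parallel.hyps(2) ab] by metis
    then have "c e + c f \<le> \<Lambda>" by (simp add: c'_def)
    then show ?thesis using True sp_parallel.prems(1)[of e] sp_parallel.prems(1)[of f] sp_parallel.hyps(2)
      by (simp add: c'_def v'_def good_edge_parallel)
  next
    case False
    then show ?thesis using that sp_parallel.prems(1)[of i] by (simp add: c'_def v'_def)
  qed
  then have "tutte_Z V E ends q v' \<noteq> 0" using sep by (rule sp_parallel.IH)
  moreover have "tutte_Z V (insert f E) ?n q v = tutte_Z V E ?n q v'"
    unfolding A(1) v'_def using A ab ne by (intro tutte_Z_parallel[where a = a and b = b]) auto
  moreover have "tutte_Z V E ?n q v' = tutte_Z V E ends q v'"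
    using A by (intro tutte_Z_cong) auto
  ultimately show ?case unfolding fun_upd_def by simp
next
  case (sp_series V E ends e a b w f)
  have G: "multigraph V E ends" "loopless V E ends"
    using series_parallel_simple[OF sp_series.hyps(1)] by auto
  define A where "A = E - {e}"
  have A: "E = insert e A" "finite A" "e \<notin> A" "f \<notin> insert e A"
    using sp_series.hyps G by (auto simp: A_def multigraph_def)
  have V: "finite V" "a \<in> V" "b \<in> V" "w \<notin> V" and AV: "\<And>i. i \<in> A \<Longrightarrow> ends i \<subseteq> V"
    using sp_series.hyps G A by (auto simp: multigraph_def)
  define n where "n = ends(e := {a, w}, f := {w, b})"
  have n: "n e = {a, w}" "n f = {w, b}" "\<And>i. i \<in> A \<Longrightarrow> n i = ends i" using A by (auto simp: n_def)
  have "series_parallel (insert w V) (insert f E) n"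
    unfolding n_def using sp_series.hyps by (intro series_parallel.sp_series)
  then have G': "multigraph (insert w V) (insert f E) n" "loopless (insert w V) (insert f E) n"
    using series_parallel_simple by blast+
  have sep': "separated (insert w V) (insert f E) n c \<Lambda>" using sp_series.prems(2) by (simp add: n_def fun_upd_def)
  have good: "good_edge (c i) (v i)" if "i \<in> insert f E" for i using sp_series.prems(1) that by simp
  have pos: "1 \<le> c i" if "i \<in> insert f E" for i using good[OF that] by (simp add: good_edge_def)
  \<comment> \<open>The reset preserves separation: a cut through \<open>e\<close> in the smaller
    graph contains \<open>e\<close> or \<open>f\<close> in the larger one, and each has capacity at
    least 1.\<close>
  define c' where "c' = c(e := 1)"
  have ecut: "e \<in> edge_cut (insert f E) n X \<or> f \<in> edge_cut (insert f E) n X" if "e \<in> edge_cut E ends X" for X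
    using that n sp_series.hyps(2,3) unfolding edge_cut_def by (auto simp: sp_series.hyps(3))
  have Acut: "i \<in> edge_cut (insert f E) n X" if "i \<in> edge_cut E ends X" "i \<noteq> e" for X i
    using that n(3)[of i] A by (auto simp: edge_cut_def)
  have sep: "separated V E ends c' \<Lambda>"
    unfolding separated_def
  proof (intro ballI impI)
    fix x y assume xy: "x \<in> V" "y \<in> V" "x \<noteq> y"
    then obtain X where X: "x \<in> X" "y \<notin> X" "sum c (edge_cut (insert f E) n X) \<le> \<Lambda>"
      using sep' unfolding separated_def by blast
    let ?C = "edge_cut E ends X" and ?C' = "edge_cut (insert f E) n X"
    have fin: "finite ?C" "finite ?C'" using A by (auto simp: edge_cut_def)
    have "sum c' ?C \<le> sum c ?C'"
    proof (cases "e \<in> ?C")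
      case True
      then obtain g where g: "g \<in> ?C'" "g \<in> {e, f}" using ecut by blast
      have "sum c' ?C = 1 + sum c' (?C - {e})"
        using sum.remove[OF fin(1) True, of c'] by (simp add: c'_def)
      also have "sum c' (?C - {e}) = sum c (?C - {e})" by (intro sum.cong) (auto simp: c'_def)
      also have "1 + sum c (?C - {e}) \<le> c g + sum c (?C' - {g})"
      proof (rule add_mono)
        show "1 \<le> c g" using g pos A by auto
        have "?C - {e} \<subseteq> ?C' - {g}" using Acut g A by (auto simp: edge_cut_def)
        then show "sum c (?C - {e}) \<le> sum c (?C' - {g})" using fin by (intro sum_mono2) auto
      qed
      also have "\<dots> = sum c ?C'" using sum.remove[OF fin(2) g(1), of c] by simp
      finally show ?thesis .
    next
      case False
      then have "sum c' ?C = sum c ?C" by (intro sum.cong) (auto simp: c'_def)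
      also have "\<dots> \<le> sum c ?C'" using Acut False fin by (intro sum_mono2) auto
      finally show ?thesis .
    qed
    show "\<exists>X. x \<in> X \<and> y \<notin> X \<and> sum c' (edge_cut E ends X) \<le> \<Lambda>"
      using \<open>sum c' ?C \<le> sum c ?C'\<close> X by (meson le_trans)
  qed
  have Z: "tutte_Z (insert w V) (insert f E) n q v
    = (q + v e + v f) * tutte_Z V A ends q v + v e * v f * tutte_contract V A ends e q v"
    unfolding n_def A(1) using V A AV sp_series.hyps(3) by (intro tutte_Z_series) auto
  \<comment> \<open>The smaller graph with weight \<open>u\<close> on \<open>e\<close>. It is used
    with the effective series weight and, in the bridge case, with \<open>u = 0\<close>, which
    deletes \<open>e\<close>.\<close>
  have red: "tutte_Z V A ends q v + u * tutte_contract V A ends e q v \<noteq> 0" if u: "edge_region q 1 (1 + u)" for u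
  proof -
    have "good_edge (c' i) ((v(e := u)) i)" if "i \<in> E" for i
      using good_edge_region[of 1 u] Lambda u good[of i] that by (auto simp: c'_def)
    then have "tutte_Z V E ends q (v(e := u)) \<noteq> 0" using sep by (rule sp_series.IH)
    moreover have "tutte_Z V A ends q (v(e := u)) = tutte_Z V A ends q v"
      "tutte_contract V A ends e q (v(e := u)) = tutte_contract V A ends e q v"
      using A by (auto intro: tutte_Z_cong tutte_contract_cong)
    ultimately show ?thesis using A by (simp add: tutte_Z_insert)
  qed
  have nz: "q + v e \<noteq> 0" "q + v f \<noteq> 0" using good A by (auto simp: good_edge_def)
  show ?case
  proof (cases "c e < \<Lambda> \<and> c f < \<Lambda>")
    case True
    have small: "small_trans q (1 + v e)" "small_trans q (1 + v f)"
      using good_edge_small good True A by auto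
    have "tutte_Z (insert w V) (insert f E) n q v = (q + v e + v f) *
        (tutte_Z V A ends q v + v e * v f / (q + v e + v f) * tutte_contract V A ends e q v)"
      unfolding Z using series_region(1)[OF small] by (simp add: distrib_left)
    then show ?thesis
      using red[OF series_region(2)[OF small]] series_region(1)[OF small] by (simp add: n_def fun_upd_def)
  next
    case False
    \<comment> \<open>One half \<open>g\<close> has capacity at least \<Lambda>. Any further edge
      adds at least 1, so the cut between the ends of \<open>g\<close> consists of \<open>g\<close>
      alone.\<close>
    then obtain g x y where g: "g \<in> {e, f}" "\<Lambda> \<le> c g" "n g = {x, y}" using n by (metis insertCI leI)
    then have gE: "g \<in> insert f E" using A by auto
    obtain X where X: "x \<in> X" "y \<notin> X" "g \<in> edge_cut (insert f E) n X"
      "c g + sum c (edge_cut (insert f E) n X - {g}) \<le> \<Lambda>"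
      using separated_edge[OF sep' G' gE g(3)] by metis
    have only: "i = g" if "i \<in> edge_cut (insert f E) n X" for i
    proof (rule ccontr)
      assume "i \<noteq> g"
      moreover have "finite (edge_cut (insert f E) n X)" using A by (simp add: edge_cut_def)
      ultimately have "c i \<le> sum c (edge_cut (insert f E) n X - {g})"
        using that by (intro member_le_sum) auto
      moreover have "1 \<le> c i" using that pos by (simp add: edge_cut_def)
      ultimately show False using X(4) g(2) by simp
    qed
    have inX: "ends i \<subseteq> X" if "i \<in> A" "ends i \<inter> X \<noteq> {}" for i
    proof -
      have "i \<noteq> g" using that g(1) A by auto
      then show ?thesis using only[of i] that n(3)[of i] A by (auto simp: edge_cut_def)
    qed
    have "(a \<in> X) \<noteq> (b \<in> X)"
    proof -
      \<comment> \<open>Exactly one half crosses the cut, so \<open>a\<close> and \<open>b\<close>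
        lie on opposite sides wherever \<open>w\<close> lies.\<close>
      have "(e \<in> edge_cut (insert f E) n X) \<noteq> (f \<in> edge_cut (insert f E) n X)"
        using only[of e] only[of f] X(3) g(1) A(4) by blast
      moreover have "e \<in> edge_cut (insert f E) n X \<longleftrightarrow> (a \<in> X) \<noteq> (w \<in> X)"
        unfolding edge_cut_def mem_Collect_eq n(1) using A(1) by blast
      moreover have "f \<in> edge_cut (insert f E) n X \<longleftrightarrow> (w \<in> X) \<noteq> (b \<in> X)"
        unfolding edge_cut_def mem_Collect_eq n(2) by blast
      ultimately show ?thesis by blast
    qed
    then have br: "tutte_Z V A ends q v = q * tutte_contract V A ends e q v"
    proof (cases "a \<in> X")
      case True
      then show ?thesis using \<open>(a \<in> X) \<noteq> (b \<in> X)\<close> V sp_series.hyps(3) inX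
        by (intro tutte_contract_bridge[of V a b]) auto
    next
      case False
      then show ?thesis using \<open>(a \<in> X) \<noteq> (b \<in> X)\<close> V sp_series.hyps(3) inX
        by (intro tutte_contract_bridge[of V b a]) auto
    qed
    have "tutte_Z V A ends q v \<noteq> 0"
      using red[of 0] edge_region_real[of 1 1] by simp
    then have "tutte_contract V A ends e q v \<noteq> 0" using br by auto
    \<comment> \<open>For a bridge the coefficient \<open>(q + v e + v f) * q + v e * v f\<close>
      factors, so nonvanishing of \<open>q + v e\<close> and \<open>q + v f\<close>
      suffices.\<close>
    moreover have "tutte_Z (insert w V) (insert f E) n q v
        = (q + v e) * (q + v f) * tutte_contract V A ends e q v"
      unfolding Z br by (simp add: algebra_simps)
    ultimately show ?thesis using nz by (simp add: n_def fun_upd_def)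
  qed
qed

end

theorem theorem1p5:
  fixes V :: "'v set" and E :: "'e set" and ends :: "'e \<Rightarrow> 'v set"
    and \<Lambda> :: nat and v :: "'e \<Rightarrow> real" and q :: complex
  assumes "\<Lambda> \<ge> 2"
    and "multigraph V E ends"
    and "loopless V E ends"
    and "series_parallel V E ends"
    and "maxmaxflow V E ends \<le> \<Lambda>"
    and "\<forall>e\<in>E. v e \<in> {-1..0}"
    and "tutte_Z V E ends q (\<lambda>e. complex_of_real (v e)) = 0"
  shows "cmod (q - 1) < (real \<Lambda> - 1) / ln 2"
proof (rule ccontr)
  assume "\<not> cmod (q - 1) < (real \<Lambda> - 1) / ln 2"
  then interpret root_param q \<Lambda>
    using assms(1) by unfold_locales auto
  have "good_edge 1 (complex_of_real (v e))" if "e \<in> E" for e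
  proof -
    \<comment> \<open>Weights in [-1,0] mean that \<open>y = 1 + v e\<close> lies in [0,1].\<close>
    have "edge_region q 1 (complex_of_real (1 + v e))"
      using assms(6) that by (intro edge_region_real) auto
    then show ?thesis using Lambda by (intro good_edge_region) auto
  qed
  \<comment> \<open>With unit capacities the capacity of a cut is its number of edges, bounded by
    the maxmaxflow for a suitable cut.\<close>
  moreover have "separated V E ends (\<lambda>_. 1) \<Lambda>"
    unfolding separated_def using maxmaxflow_cut[OF assms(2,3)] assms(5)
    by (metis card_eq_sum le_trans)
  ultimately have "tutte_Z V E ends q (\<lambda>e. complex_of_real (v e)) \<noteq> 0"
    by (rule tutte_Z_nonzero[OF assms(4)])
  then show False using assms(7) by contradiction
qed

end
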